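(* Let $d\in\mathbb{N}$ and let $X=(X_t)_{t\ge 0}$ be a Lévy process in $\mathbb{R}^d$. For a Borel function $q:\mathbb{R}^d\to\mathbb{R}$ consider the two conditions (I) $\displaystyle\lim_{t\to 0^+}\Big[\sup_{x\in\mathbb{R}^d}\mathbb{E}^x\Big(\int_0^t|q(X_u)|\,du\Big)\Big]=0$; (II) $\displaystyle\lim_{r\to 0^+}\Big[\sup_{x\in\mathbb{R}^d}\mathbb{E}^x\Big(\int_0^\infty e^{-\lambda u}\mathbf 1_{B(x,r)}(X_u)|q(X_u)|\,du\Big)\Big]=0$ for some (equivalently, for every) $\lambda>0$. Then (I) and (II) are not equivalent (that is, the class of Borel functions $q$ satisfying (I) differs from the class of Borel functions $q$ satisfying (II)) if and only if $0$ is regular for $\{0\}$.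
   Context: $\mathbb{P}^x,\mathbb{E}^x$ denote the law and expectation of the Lévy process started at $x$, i.e. $\mathbb{E}^xF(X)=\mathbb{E}^0F(X+x)$. $B(x,r)$ is the open Euclidean ball. For a Borel set $B$, $T_B=\inf\{t>0: X_t\in B\}$ ($\inf\emptyset=\infty$). A point $x$ is regular for a Borel set $B$ if $\mathbb{P}^x(T_B=0)=1$. *)

theory Defs
  imports "HOL-Probability.Probability"
begin

text \<open>
  Time is the half-line of nonnegative reals; the values of \<^term>\<open>X t\<close> for negative \<^term>\<open>t\<close>
  are unconstrained and never used. Stochastic continuity is implied by the other assumptions
  and is listed because it is customary. The underlying probability space need not be complete, and
  the path properties hold almost surely.
\<close>

locale levy_process = prob_space M for M :: "'w measure" +
  fixes X :: "real \<Rightarrow> 'w \<Rightarrow> real ^ 'n"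
  assumes random_variable_X: "\<And>t. 0 \<le> t \<Longrightarrow> random_variable borel (X t)"
    and start_zero: "AE \<omega> in M. X 0 \<omega> = 0"
    and indep_increments:
      "\<And>(n :: nat) t. 0 \<le> t 0 \<Longrightarrow> (\<And>i. i < n \<Longrightarrow> t i \<le> t (Suc i)) \<Longrightarrow>
         indep_vars (\<lambda>_. borel) (\<lambda>i \<omega>. X (t (Suc i)) \<omega> - X (t i) \<omega>) {..<n}"
    and stationary_increments:
      "\<And>s t. 0 \<le> s \<Longrightarrow> 0 \<le> t \<Longrightarrow>
         distr M borel (\<lambda>\<omega>. X (s + t) \<omega> - X s \<omega>) = distr M borel (X t)"
    and stochastically_continuous:
      "\<And>s \<epsilon>. 0 \<le> s \<Longrightarrow> 0 < \<epsilon> \<Longrightarrow>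
         ((\<lambda>t. prob {\<omega> \<in> space M. \<epsilon> < norm (X t \<omega> - X s \<omega>)}) \<longlongrightarrow> 0) (at s within {0..})"
    and cadlag:
      "AE \<omega> in M. (\<forall>t\<ge>0. ((\<lambda>s. X s \<omega>) \<longlongrightarrow> X t \<omega>) (at_right t)) \<and>
                  (\<forall>t>0. \<exists>l. ((\<lambda>s. X s \<omega>) \<longlongrightarrow> l) (at_left t))"

text \<open>
  As \<^term>\<open>X\<close> starts at the origin, the process started at \<^term>\<open>x\<close> is \<^term>\<open>\<lambda>t \<omega>. x + X t \<omega>\<close>.
  The functionals are \<open>[0,\<infinity>]\<close>-valued, so the expectation is a nonnegative Lebesgue integral.
\<close>

definition expectation_from ::
    "'w measure \<Rightarrow> (real \<Rightarrow> 'w \<Rightarrow> real ^ 'n) \<Rightarrow> real ^ 'n \<Rightarrow> ((real \<Rightarrow> real ^ 'n) \<Rightarrow> ennreal) \<Rightarrow> ennreal"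
  where "expectation_from M X x F = (\<integral>\<^sup>+\<omega>. F (\<lambda>t. x + X t \<omega>) \<partial>M)"

definition hitting_time :: "(real \<Rightarrow> real ^ 'n) \<Rightarrow> (real ^ 'n) set \<Rightarrow> ereal"
  where "hitting_time Y B = Inf (ereal ` {t. 0 < t \<and> Y t \<in> B})"

text \<open>
  The event that the hitting time vanishes is in general only measurable for the completion of
  \<^term>\<open>M\<close>; ``almost everywhere'' says that its complement is contained in a null set of \<^term>\<open>M\<close>,
  that is, that it has probability one for the completed measure.
\<close>

definition regular_for ::
    "'w measure \<Rightarrow> (real \<Rightarrow> 'w \<Rightarrow> real ^ 'n) \<Rightarrow> real ^ 'n \<Rightarrow> (real ^ 'n) set \<Rightarrow> bool"
  where "regular_for M X x B \<longleftrightarrow> (AE \<omega> in M. hitting_time (\<lambda>t. x + X t \<omega>) B = 0)"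

definition condition_I ::
    "'w measure \<Rightarrow> (real \<Rightarrow> 'w \<Rightarrow> real ^ 'n) \<Rightarrow> (real ^ 'n \<Rightarrow> real) \<Rightarrow> bool"
  where "condition_I M X q \<longleftrightarrow>
    ((\<lambda>t. SUP x. expectation_from M X x (\<lambda>Y. \<integral>\<^sup>+u\<in>{0..t}. ennreal \<bar>q (Y u)\<bar> \<partial>lborel))
       \<longlongrightarrow> 0) (at_right 0)"

definition condition_II ::
    "'w measure \<Rightarrow> (real \<Rightarrow> 'w \<Rightarrow> real ^ 'n) \<Rightarrow> real \<Rightarrow> (real ^ 'n \<Rightarrow> real) \<Rightarrow> bool"
  where "condition_II M X l q \<longleftrightarrow>
    ((\<lambda>r. SUP x. expectation_from M X x (\<lambda>Y.
            \<integral>\<^sup>+u\<in>{0..}. ennreal (exp (- l * u) * indicator (ball x r) (Y u) * \<bar>q (Y u)\<bar>) \<partial>lborel))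
       \<longlongrightarrow> 0) (at_right 0)"

end

theory Submission
  imports Defs
begin

text \<open>
  Write \<open>G f x\<close> for the potential \<open>E\<^sup>x \<integral> e\<^sup>-\<^sup>\<lambda>\<^sup>u f(X\<^sub>u) du\<close>. The strong Markov property at the entrance time \<open>T\<close> of
  an open set \<open>V\<close> bounds the part of \<open>G f\<close> accumulated on \<open>V\<close> by \<open>E[e\<^sup>-\<^sup>\<lambda>\<^sup>T]\<close> times the supremum of \<open>G f\<close> over \<open>V\<close>. With
  \<open>V\<close> a ball this is a maximum principle, and (II) does not depend on the rate; with \<open>V\<close> the complement of a
  ball it gives (II) \<open>\<Longrightarrow>\<close> (I) for every process.

  If \<open>0\<close> is not regular for \<open>{0}\<close>, quasi-left-continuity keeps the discounted probability of returning to a small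
  ball after a time \<open>t\<close> below some \<open>K < 1\<close>, uniformly in \<open>t\<close>, and then (I) \<open>\<Longrightarrow>\<close> (II). If \<open>0\<close> is regular for \<open>{0}\<close>, the
  process returns to its starting point immediately, so the occupation up to time \<open>t\<close> is an arbitrarily
  small fraction of the potential; hence (I) only requires a bounded potential, which a sum of
  far-apart normalised bumps on shrinking balls satisfies while violating (II).
\<close>

text \<open>Entrance times are only observed on grids of mesh \<open>1 / (m + 1)\<close>. There they
  take countably many values, so independence of finitely many increments gives the strong Markov
  property, and Fatou's lemma lets the mesh tend to \<open>0\<close>. An inequality
  \<open>S \<le> C + k * S\<close> says nothing about an infinite \<open>S\<close>; hence the
  truncations and crude bounds that make each supremum finite before it is absorbed. Exact visits to
  \<open>0\<close> are hard to handle: the event need not be measurable, and such visits are not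
  seen by grids. The estimates therefore use visits to small open balls, and exact visits come back
  only through quasi-left-continuity. Two uniformities carry the equivalence. In the non-regular
  case \<open>K\<close> must not depend on \<open>t\<close>, since \<open>t\<close> is chosen after
  \<open>K\<close> and only the radius may depend on \<open>t\<close>. In the regular case one time
  \<open>t\<close> must serve all radii, open sets and starting points, so that the estimate can be
  summed over the bumps.\<close>

lemma indicator_mult_mono:
  fixes a b :: ennreal
  shows "(\<omega> \<in> A \<Longrightarrow> a \<le> b) \<Longrightarrow> indicator A \<omega> * a \<le> indicator A \<omega> * b"
  by (auto split: split_indicator)

lemma suminf_subsingleton:
  fixes g :: "nat \<Rightarrow> ennreal"
  assumes "\<And>j. g j \<noteq> 0 \<Longrightarrow> j = k" shows "(\<Sum>j. g j) = g k"
proof -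
  have "g = (\<lambda>j. if j = k then g j else 0)"
    by (rule ext) (metis assms)
  then show ?thesis using sums_unique[OF sums_single[of k g]] by simp
qed

text \<open>The value \<open>a = \<infinity>\<close> satisfies the first inequality whenever
  \<open>0 < k\<close>, so finiteness is what permits absorbing \<open>k * a\<close> on the left. It
  is secured at each use by truncation or by an a priori bound.\<close>

lemma ennreal_le_contraction:
  fixes a c :: ennreal
  assumes "a \<le> c + ennreal k * a" "a < \<infinity>" "0 \<le> k" "k < 1"
  shows "a \<le> c * ennreal (1 / (1 - k))"
proof (cases c)
  case (real c')
  obtain a' where a: "a = ennreal a'" "0 \<le> a'" using assms(2) by (cases a) auto
  have "a' \<le> c' + k * a'"
    using assms(1,3) real a by (simp add: ennreal_mult[symmetric] ennreal_plus[symmetric] del: ennreal_plus)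
  then have "a' \<le> c' * (1 / (1 - k))" using assms(4) by (simp add: field_simps)
  then show ?thesis using real a assms by (simp add: ennreal_mult[symmetric] ennreal_leI)
next
  case top
  then show ?thesis using assms by (simp add: ennreal_top_mult)
qed

lemma SUP_min_of_nat: "(SUP N. min (a :: ennreal) (of_nat N)) = a"
proof (rule antisym)
  show "a \<le> (SUP N. min a (of_nat N))"
  proof (cases a)
    case (real r)
    obtain N where "r \<le> real N" using real_arch_simple by blast
    then have "a \<le> of_nat N" using real by (metis ennreal_leI ennreal_of_nat_eq_real_of_nat)
    then show ?thesis by (intro SUP_upper2[of N]) auto
  qed (simp add: ennreal_SUP_of_nat_eq_top)
qed (auto intro: SUP_least)

lemma sets_borel_ball[measurable]: "ball (x :: 'a::metric_space) r \<in> sets borel"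
  by simp

text \<open>The quantities shrink with \<open>t\<close>, so one good \<open>t\<close> for each
  \<open>e\<close> is enough. This turns the limits in (I) and (II) into
  \<open>small_time_kato\<close> and \<open>small_ball_kato\<close>.\<close>

lemma SUP_tendsto_0_at_right_iff:
  fixes g :: "real \<Rightarrow> 'a \<Rightarrow> ennreal"
  assumes mono: "\<And>s t x. s \<le> t \<Longrightarrow> g s x \<le> g t x"
  shows "((\<lambda>t. SUP x. g t x) \<longlongrightarrow> 0) (at_right 0) \<longleftrightarrow> (\<forall>e>0. \<exists>t>0. \<forall>x. g t x \<le> ennreal e)"
proof safe
  fix e :: real assume lim: "((\<lambda>t. SUP x. g t x) \<longlongrightarrow> 0) (at_right 0)" and e: "0 < e"
  have "\<forall>\<^sub>F t in at_right 0. (SUP x. g t x) < ennreal e"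
    using lim e by (intro order_tendstoD(2)) auto
  then obtain b where b: "0 < b" "\<And>t. 0 < t \<Longrightarrow> t < b \<Longrightarrow> (SUP x. g t x) < ennreal e"
    by (auto simp: eventually_at_right_field)
  have "(SUP x. g (b / 2) x) \<le> ennreal e" using b by (intro less_imp_le b(2)) auto
  then have "\<forall>x. g (b / 2) x \<le> ennreal e" by (simp add: SUP_le_iff)
  then show "\<exists>t>0. \<forall>x. g t x \<le> ennreal e" using b(1) by (intro exI[of _ "b / 2"]) auto
next
  assume small: "\<forall>e>0. \<exists>t>0. \<forall>x. g t x \<le> ennreal e"
  show "((\<lambda>t. SUP x. g t x) \<longlongrightarrow> 0) (at_right 0)"
  proof (rule order_tendstoI)
    fix a :: ennreal assume "0 < a"
    then obtain c where c: "0 < c" "c < a" using dense by blast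
    then obtain e where e: "c = ennreal e" "0 < e" by (cases c) auto
    then obtain t where t: "0 < t" "\<And>x. g t x \<le> ennreal e" using small by blast
    have "(SUP x. g s x) < a" if "s < t" for s
    proof -
      have "(SUP x. g s x) \<le> ennreal e"
        using that by (intro SUP_least order_trans[OF mono t(2)]) simp
      then show ?thesis using c e by (simp add: order.strict_trans1)
    qed
    then show "\<forall>\<^sub>F t in at_right 0. (SUP x. g t x) < a"
      using t(1) unfolding eventually_at_right_field by blast
  qed simp
qed

section \<open>The Markov property\<close>

text \<open>
  The normalisations at nonpositive times, off the sample space and on exceptional null sets cost nothing
  (see \<open>right_continuous_version\<close>) and make \<^term>\<open>\<lambda>(t, \<omega>). X t \<omega>\<close> jointly measurable.
\<close>

locale right_continuous_levy = prob_space M for M :: "'w measure" +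
  fixes X :: "real \<Rightarrow> 'w \<Rightarrow> 'a::euclidean_space"
  assumes X_measurable: "\<And>t. X t \<in> borel_measurable M"
    and X_nonpos: "\<And>t \<omega>. t \<le> 0 \<Longrightarrow> X t \<omega> = 0"
    and X_outside: "\<And>t \<omega>. \<omega> \<notin> space M \<Longrightarrow> X t \<omega> = 0"
    and X_rc: "\<And>t \<omega>. ((\<lambda>s. X s \<omega>) \<longlongrightarrow> X t \<omega>) (at_right t)"
    and X_indep: "\<And>(n :: nat) t. 0 \<le> t 0 \<Longrightarrow> (\<And>i. i < Suc n \<Longrightarrow> t i \<le> t (Suc i)) \<Longrightarrow>
         indep_vars (\<lambda>_. borel) (\<lambda>i \<omega>. X (t (Suc i)) \<omega> - X (t i) \<omega>) {..<Suc n}"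
    and X_stat: "\<And>s t. 0 \<le> s \<Longrightarrow> 0 \<le> t \<Longrightarrow>
         distr M borel (\<lambda>\<omega>. X (s + t) \<omega> - X s \<omega>) = distr M borel (X t)"
begin

text \<open>Replacing the time by a grid point strictly to its right gives an approximation that
  uses only countably many \<open>X t\<close>; right-continuity makes it converge.\<close>

lemma X_joint: "(\<lambda>p. X (fst p) (snd p)) \<in> borel_measurable (borel \<Otimes>\<^sub>M M)"
proof (rule borel_measurable_LIMSEQ_metric)
  fix n :: nat
  have "(\<lambda>p::real \<times> 'w. \<lfloor>real (Suc n) * fst p\<rfloor>) \<in> borel \<Otimes>\<^sub>M M \<rightarrow>\<^sub>M count_space UNIV"
    by measurable
  then show "(\<lambda>p. X (of_int (\<lfloor>real (Suc n) * fst p\<rfloor> + 1) / real (Suc n)) (snd p))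
      \<in> borel_measurable (borel \<Otimes>\<^sub>M M)"
    by (rule measurable_compose_countable[rotated])
       (use X_measurable in measurable)
next
  fix p :: "real \<times> 'w" assume "p \<in> space (borel \<Otimes>\<^sub>M M)"
  define g where "g n = of_int (\<lfloor>real (Suc n) * fst p\<rfloor> + 1) / real (Suc n)" for n
  have gt: "fst p < g n" for n
    unfolding g_def by (simp add: field_simps) linarith
  have le: "g n \<le> fst p + 1 / real (Suc n)" for n
  proof -
    have "g n \<le> (real (Suc n) * fst p + 1) / real (Suc n)"
      unfolding g_def by (intro divide_right_mono) linarith+
    then show ?thesis by (simp add: add_divide_distrib)
  qed
  have "g \<longlonglongrightarrow> fst p"
  proof (rule tendsto_sandwich)
    show "(\<lambda>n. fst p) \<longlonglongrightarrow> fst p" by simp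
    show "(\<lambda>n. fst p + 1 / real (Suc n)) \<longlonglongrightarrow> fst p"
      using tendsto_add[OF tendsto_const[of "fst p"] LIMSEQ_Suc[OF lim_1_over_n]] by simp
  qed (use gt le in \<open>auto intro!: always_eventually less_imp_le\<close>)
  then have "filterlim g (at_right (fst p)) sequentially"
    using gt by (auto simp: filterlim_at less_imp_neq[symmetric])
  from filterlim_compose[OF X_rc this]
  show "(\<lambda>n. X (of_int (\<lfloor>real (Suc n) * fst p\<rfloor> + 1) / real (Suc n)) (snd p))
      \<longlonglongrightarrow> X (fst p) (snd p)"
    by (simp add: g_def)
qed

lemma measurable_X[measurable (raw)]:
  assumes "f \<in> borel_measurable N" "g \<in> N \<rightarrow>\<^sub>M M"
  shows "(\<lambda>x. X (f x) (g x)) \<in> borel_measurable N"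
  using measurable_compose[OF measurable_Pair[OF assms] X_joint] by simp

lemma measurable_path[measurable]: "(\<lambda>u. X u \<omega>) \<in> borel_measurable borel"
proof (cases "\<omega> \<in> space M")
  case True
  then show ?thesis by (intro measurable_X) auto
qed (simp add: X_outside)

text \<open>The positions at the times \<open>s j\<close> are sums of increments independent of the
  last increment, which has the law of \<open>X u\<close>. Cylinder events suffice as the past,
  because grid entrance events are of this form.\<close>

lemma markov:
  fixes s :: "nat \<Rightarrow> real" and F :: "'a \<Rightarrow> 'a \<Rightarrow> ennreal"
  assumes s0: "0 \<le> s 0" and mono: "\<And>i. i < k \<Longrightarrow> s i \<le> s (Suc i)" and u: "0 \<le> u"
    and B[measurable]: "\<And>j. B j \<in> sets borel"
    and F[measurable]: "(\<lambda>p. F (fst p) (snd p)) \<in> borel_measurable (borel \<Otimes>\<^sub>M borel)"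
  shows "(\<integral>\<^sup>+\<omega>. indicator {\<omega>. \<forall>j\<le>k. X (s j) \<omega> \<in> B j} \<omega> *
            F (X (s k) \<omega>) (X (s k + u) \<omega> - X (s k) \<omega>) \<partial>M)
       = (\<integral>\<^sup>+\<omega>. indicator {\<omega>. \<forall>j\<le>k. X (s j) \<omega> \<in> B j} \<omega> *
            (\<integral>\<^sup>+\<omega>'. F (X (s k) \<omega>) (X u \<omega>') \<partial>M) \<partial>M)"
proof -
  \<comment> \<open>Time \<open>0\<close> is put in front, so that with \<open>X 0 = 0\<close> the
    sums of increments are the positions themselves; index \<open>Suc k\<close> is the fresh
    increment.\<close>
  define t where "t i = (case i of 0 \<Rightarrow> 0 | Suc i \<Rightarrow> if i \<le> k then s i else s k + u)" for i
  define D where "D i \<omega> = X (t (Suc i)) \<omega> - X (t i) \<omega>" for i \<omega>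
  define \<Phi> where "\<Phi> \<omega> = restrict (\<lambda>i. D i \<omega>) {..k}" for \<omega>
  define P where "P = (PiM {..k} (\<lambda>_. borel :: 'a measure))"
  define Q where "Q = (PiM {Suc k} (\<lambda>_. borel :: 'a measure))"
  define Y where "Y \<omega> = restrict (\<lambda>i. D i \<omega>) {Suc k}" for \<omega>
  define S where "S j \<phi> = (\<Sum>i<Suc j. \<phi> i :: 'a)" for j \<phi>
  define I where "I \<phi> = (indicator {\<phi>. \<forall>j\<le>k. S j \<phi> \<in> B j} \<phi> :: ennreal)" for \<phi>
  define G where "G p = I (fst p) * F (S k (fst p)) (snd p (Suc k))"
    for p :: "(nat \<Rightarrow> 'a) \<times> (nat \<Rightarrow> 'a)"
  have "indep_vars (\<lambda>_. borel) D {..<Suc (Suc k)}"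
    unfolding D_def
  proof (rule X_indep)
    show "t i \<le> t (Suc i)" if "i < Suc (Suc k)" for i
      using that s0 mono u by (auto simp: t_def le_less_Suc_eq not_le split: nat.split)
  qed (simp add: t_def)
  then have "indep_var P \<Phi> (PiM {Suc k} (\<lambda>_. borel)) (\<lambda>\<omega>. restrict (\<lambda>i. D i \<omega>) {Suc k})"
    unfolding P_def \<Phi>_def by (rule indep_var_restrict) auto
  then have ind: "indep_var P \<Phi> Q Y"
    by (simp add: Q_def Y_def[abs_def])
  have S\<Phi>: "S j (\<Phi> \<omega>) = X (s j) \<omega>" if "j \<le> k" for j \<omega>
  proof -
    have "S j (\<Phi> \<omega>) = (\<Sum>i<Suc j. X (t (Suc i)) \<omega> - X (t i) \<omega>)"
      unfolding S_def \<Phi>_def D_def using that by (intro sum.cong) auto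
    also have "\<dots> = X (t (Suc j)) \<omega> - X (t 0) \<omega>"
      by (rule sum_lessThan_telescope)
    finally show ?thesis using that by (simp add: t_def X_nonpos)
  qed
  have D_last: "D (Suc k) \<omega> = X (s k + u) \<omega> - X (s k) \<omega>" for \<omega>
    by (simp add: D_def t_def)
  have [measurable]: "S j \<in> borel_measurable P" if "j \<le> k" for j
    unfolding S_def P_def using that by (intro borel_measurable_sum measurable_component_singleton) auto
  have [measurable]: "I \<in> borel_measurable P"
    unfolding I_def
  proof (subst borel_measurable_indicator_iff)
    have "(\<Inter>j\<in>{..k}. S j -` B j \<inter> space P) \<in> sets P"
      by (intro sets.finite_INT measurable_sets[where A=borel]) auto
    also have "(\<Inter>j\<in>{..k}. S j -` B j \<inter> space P) = {\<phi>. \<forall>j\<le>k. S j \<phi> \<in> B j} \<inter> space P"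
      by auto
    finally show "{\<phi>. \<forall>j\<le>k. S j \<phi> \<in> B j} \<inter> space P \<in> sets P" .
  qed
  have [measurable]: "(\<lambda>y. y (Suc k)) \<in> borel_measurable Q"
    unfolding Q_def by (intro measurable_component_singleton) auto
  have [measurable]: "G \<in> borel_measurable (P \<Otimes>\<^sub>M Q)"
  proof -
    have "(\<lambda>p. (S k (fst p), snd p (Suc k))) \<in> P \<Otimes>\<^sub>M Q \<rightarrow>\<^sub>M borel \<Otimes>\<^sub>M borel"
      by measurable
    from measurable_compose[OF this F]
    have "(\<lambda>p. F (S k (fst p)) (snd p (Suc k))) \<in> borel_measurable (P \<Otimes>\<^sub>M Q)"
      by simp
    then show ?thesis
      unfolding G_def by (intro borel_measurable_times_ennreal) measurable
  qed
  have rv[measurable]: "\<Phi> \<in> M \<rightarrow>\<^sub>M P" "Y \<in> M \<rightarrow>\<^sub>M Q"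
    using ind by (auto dest: indep_var_rv1 indep_var_rv2)
  have pair: "distr M P \<Phi> \<Otimes>\<^sub>M distr M Q Y = distr M (P \<Otimes>\<^sub>M Q) (\<lambda>x. (\<Phi> x, Y x))"
    using ind by (simp add: indep_var_distribution_eq)
  have stat: "distr M borel (D (Suc k)) = distr M borel (X u)"
  proof -
    have "0 \<le> s j" if "j \<le> k" for j using that
      by (induction j) (use s0 mono in \<open>auto intro: order_trans\<close>)
    then show ?thesis unfolding D_last[abs_def] using u by (intro X_stat) auto
  qed
  have F1[measurable]: "F z \<in> borel_measurable borel" for z
    using measurable_compose[OF measurable_Pair1'[of z borel borel] F] by simp
  have D_meas[measurable]: "D i \<in> borel_measurable M" for i
    unfolding D_def using X_measurable by measurable
  interpret Y: prob_space "distr M Q Y" by (rule prob_space_distr) simp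
  have "(\<integral>\<^sup>+\<omega>. indicator {\<omega>. \<forall>j\<le>k. X (s j) \<omega> \<in> B j} \<omega> *
            F (X (s k) \<omega>) (X (s k + u) \<omega> - X (s k) \<omega>) \<partial>M) = (\<integral>\<^sup>+\<omega>. G (\<Phi> \<omega>, Y \<omega>) \<partial>M)"
    by (intro nn_integral_cong) (auto simp: G_def I_def S\<Phi> D_last Y_def split: split_indicator)
  also have "\<dots> = (\<integral>\<^sup>+p. G p \<partial>distr M (P \<Otimes>\<^sub>M Q) (\<lambda>x. (\<Phi> x, Y x)))"
    by (simp add: nn_integral_distr)
  also have "\<dots> = (\<integral>\<^sup>+\<phi>. \<integral>\<^sup>+y. G (\<phi>, y) \<partial>distr M Q Y \<partial>distr M P \<Phi>)"
    unfolding pair[symmetric] by (subst Y.nn_integral_fst[symmetric]) auto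
  also have "\<dots> = (\<integral>\<^sup>+\<phi>. \<integral>\<^sup>+\<omega>'. G (\<phi>, Y \<omega>') \<partial>M \<partial>distr M P \<Phi>)"
    by (intro nn_integral_cong nn_integral_distr) auto
  also have "\<dots> = (\<integral>\<^sup>+\<omega>. \<integral>\<^sup>+\<omega>'. G (\<Phi> \<omega>, Y \<omega>') \<partial>M \<partial>M)"
    by (subst nn_integral_distr) auto
  also have "\<dots> = (\<integral>\<^sup>+\<omega>. indicator {\<omega>. \<forall>j\<le>k. X (s j) \<omega> \<in> B j} \<omega> *
            (\<integral>\<^sup>+\<omega>'. F (X (s k) \<omega>) (D (Suc k) \<omega>') \<partial>M) \<partial>M)"
    by (intro nn_integral_cong) (auto simp: G_def I_def S\<Phi> Y_def split: split_indicator)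
  also have "\<dots> = (\<integral>\<^sup>+\<omega>. indicator {\<omega>. \<forall>j\<le>k. X (s j) \<omega> \<in> B j} \<omega> *
            (\<integral>\<^sup>+y. F (X (s k) \<omega>) y \<partial>distr M borel (D (Suc k))) \<partial>M)"
    by (subst nn_integral_distr) auto
  also have "\<dots> = (\<integral>\<^sup>+\<omega>. indicator {\<omega>. \<forall>j\<le>k. X (s j) \<omega> \<in> B j} \<omega> *
            (\<integral>\<^sup>+\<omega>'. F (X (s k) \<omega>) (X u \<omega>') \<partial>M) \<partial>M)"
    unfolding stat using X_measurable by (subst nn_integral_distr) auto
  finally show ?thesis .
qed

section \<open>Discounted occupation functionals\<close>

text \<open>
  \<open>occ l {0..} f\<close> is the \<open>l\<close>-potential of \<open>f\<close>, and \<open>occ 0 {0..t} f\<close> is the functional of condition (I).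
\<close>

definition occ :: "real \<Rightarrow> real set \<Rightarrow> ('a \<Rightarrow> ennreal) \<Rightarrow> 'a \<Rightarrow> ennreal" where
  "occ l I f x = (\<integral>\<^sup>+\<omega>. \<integral>\<^sup>+u. ennreal (exp (- l * u)) * indicator I u * f (x + X u \<omega>) \<partial>lborel \<partial>M)"

lemma occ_eq_integral_time:
  assumes [measurable]: "f \<in> borel_measurable borel" "I \<in> sets borel"
  shows "occ l I f x = (\<integral>\<^sup>+u. ennreal (exp (- l * u)) * indicator I u * (\<integral>\<^sup>+\<omega>. f (x + X u \<omega>) \<partial>M) \<partial>lborel)"
proof -
  interpret pair_sigma_finite lborel M ..
  have "occ l I f x = (\<integral>\<^sup>+u. \<integral>\<^sup>+\<omega>. ennreal (exp (- l * u)) * indicator I u * f (x + X u \<omega>) \<partial>M \<partial>lborel)"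
    unfolding occ_def by (rule Fubini') measurable
  then show ?thesis by (simp add: nn_integral_cmult)
qed

lemma measurable_occ[measurable]:
  assumes [measurable]: "f \<in> borel_measurable borel" "I \<in> sets borel"
  shows "occ l I f \<in> borel_measurable borel"
  unfolding occ_def[abs_def] by measurable

lemma occ_mono:
  assumes "\<And>y. f y \<le> g y" "I \<subseteq> J"
  shows "occ l I f x \<le> occ l J g x"
  unfolding occ_def using assms
  by (intro nn_integral_mono mult_mono) (auto split: split_indicator)

lemma occ_mono_weight:
  assumes "\<And>u. u \<in> I \<Longrightarrow> exp (- l * u) \<le> c * exp (- k * u)" "0 \<le> c"
    and [measurable]: "f \<in> borel_measurable borel" "I \<in> sets borel"
  shows "occ l I f x \<le> ennreal c * occ k I f x"
proof -
  have "occ l I f x \<le> (\<integral>\<^sup>+\<omega>. \<integral>\<^sup>+u. ennreal c * (ennreal (exp (- k * u)) * indicator I u * f (x + X u \<omega>)) \<partial>lborel \<partial>M)"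
    unfolding occ_def
  proof (intro nn_integral_mono)
    fix \<omega> u
    show "ennreal (exp (- l * u)) * indicator I u * f (x + X u \<omega>)
       \<le> ennreal c * (ennreal (exp (- k * u)) * indicator I u * f (x + X u \<omega>))"
      using assms(1)[of u] assms(2)
      by (auto split: split_indicator simp: mult.assoc[symmetric] ennreal_mult[symmetric] intro!: mult_right_mono ennreal_leI)
  qed
  also have "\<dots> = ennreal c * occ k I f x"
    by (simp add: occ_def nn_integral_cmult)
  finally show ?thesis .
qed

lemma occ_cmult:
  assumes [measurable]: "f \<in> borel_measurable borel" "I \<in> sets borel"
  shows "occ l I (\<lambda>y. c * f y) x = c * occ l I f x"
  by (simp add: occ_def nn_integral_cmult[symmetric] mult_ac)

lemma occ_add:
  assumes [measurable]: "f \<in> borel_measurable borel" "g \<in> borel_measurable borel" "I \<in> sets borel"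
  shows "occ l I (\<lambda>y. f y + g y) x = occ l I f x + occ l I g x"
  by (simp add: occ_def nn_integral_add[symmetric] distrib_left)

lemma occ_suminf:
  assumes [measurable]: "\<And>i. f i \<in> borel_measurable borel" "I \<in> sets borel"
  shows "occ l I (\<lambda>y. \<Sum>i. f i y) x = (\<Sum>i. occ l I (f i) x)"
  by (simp add: occ_def nn_integral_suminf[symmetric])

lemma occ_SUP:
  assumes [measurable]: "\<And>i::nat. f i \<in> borel_measurable borel" "I \<in> sets borel"
    and "incseq f"
  shows "occ l I (\<lambda>y. SUP i. f i y) x = (SUP i. occ l I (f i) x)"
proof -
  have m: "incseq (\<lambda>i u. ennreal (exp (- l * u)) * indicator I u * f i (x + X u \<omega>))" for \<omega>
    using \<open>incseq f\<close> by (auto simp: incseq_def le_fun_def intro!: mult_left_mono)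
  have m2: "incseq (\<lambda>i \<omega>. \<integral>\<^sup>+u. ennreal (exp (- l * u)) * indicator I u * f i (x + X u \<omega>) \<partial>lborel)"
    using \<open>incseq f\<close> by (auto simp: incseq_def le_fun_def intro!: nn_integral_mono mult_left_mono)
  have "occ l I (\<lambda>y. SUP i. f i y) x =
      (\<integral>\<^sup>+\<omega>. \<integral>\<^sup>+u. (SUP i. ennreal (exp (- l * u)) * indicator I u * f i (x + X u \<omega>)) \<partial>lborel \<partial>M)"
    by (simp add: occ_def SUP_mult_left_ennreal)
  also have "\<dots> = (\<integral>\<^sup>+\<omega>. (SUP i. \<integral>\<^sup>+u. ennreal (exp (- l * u)) * indicator I u * f i (x + X u \<omega>) \<partial>lborel) \<partial>M)"
  proof (rule nn_integral_cong)
    fix \<omega> assume [measurable]: "\<omega> \<in> space M"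
    show "(\<integral>\<^sup>+u. (SUP i. ennreal (exp (- l * u)) * indicator I u * f i (x + X u \<omega>)) \<partial>lborel) =
       (SUP i. \<integral>\<^sup>+u. ennreal (exp (- l * u)) * indicator I u * f i (x + X u \<omega>) \<partial>lborel)"
      by (rule nn_integral_monotone_convergence_SUP[OF m]) measurable
  qed
  also have "\<dots> = (SUP i. occ l I (f i) x)"
    unfolding occ_def by (rule nn_integral_monotone_convergence_SUP[OF m2]) measurable
  finally show ?thesis .
qed

lemma occ_shift: "occ l I (\<lambda>y. f (y + z)) x = occ l I f (x + z)"
  by (simp add: occ_def algebra_simps)

lemma occ_split:
  assumes [measurable]: "f \<in> borel_measurable borel" and "0 \<le> t"
  shows "occ l {0..} f x = occ l {0..<t} f x + occ l {t..} f x"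
proof -
  have *: "ennreal (exp (- l * u)) * indicator {0..} u * f (x + X u \<omega>) =
    ennreal (exp (- l * u)) * indicator {0..<t} u * f (x + X u \<omega>) +
    ennreal (exp (- l * u)) * indicator {t..} u * f (x + X u \<omega>)" for u \<omega>
    using \<open>0 \<le> t\<close> by (auto split: split_indicator)
  show ?thesis unfolding occ_def * by (simp add: nn_integral_add)
qed

lemma occ_const: "0 < l \<Longrightarrow> occ l {0..} (\<lambda>y. c) x = c * ennreal (1 / l)"
proof -
  assume l: "0 < l"
  have "(\<integral>\<^sup>+u. ennreal (exp (- l * u)) * indicator {0..} u \<partial>lborel) = ennreal (0 - (- exp (- l * 0) / l))"
  proof (rule nn_integral_FTC_atLeast)
    show "((\<lambda>u. - exp (- l * u) / l) \<longlongrightarrow> 0) at_top"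
      using l by real_asymp
  qed (use l in \<open>auto intro!: derivative_eq_intros\<close>)
  then have "(\<integral>\<^sup>+u. ennreal (exp (- l * u)) * indicator {0..} u * c \<partial>lborel) = ennreal (1 / l) * c"
    by (simp add: nn_integral_multc)
  then show ?thesis by (simp add: occ_def emeasure_space_1 mult.commute)
qed

lemma occ_bounded:
  assumes "0 < l" "\<And>y. f y \<le> ennreal c" shows "occ l {0..} f x < \<infinity>"
proof -
  have "occ l {0..} f x \<le> occ l {0..} (\<lambda>y. ennreal c) x" using assms by (intro occ_mono) auto
  also have "\<dots> < \<infinity>" using assms by (simp add: occ_const ennreal_mult_less_top)
  finally show ?thesis .
qed

text \<open>\<open>markov\<close> is applied at each fixed time \<open>s k + v\<close> and
  integrated over \<open>v\<close>; the substitution \<open>u = s k + v\<close> releases the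
  discount \<open>exp (- l * s k)\<close>.\<close>

lemma markov_occ:
  fixes s :: "nat \<Rightarrow> real"
  assumes s0: "0 \<le> s 0" and mono: "\<And>i. i < k \<Longrightarrow> s i \<le> s (Suc i)"
    and B[measurable]: "\<And>j. B j \<in> sets borel"
    and f[measurable]: "f \<in> borel_measurable borel"
  shows "(\<integral>\<^sup>+\<omega>. \<integral>\<^sup>+u. indicator {\<omega>. \<forall>j\<le>k. X (s j) \<omega> \<in> B j} \<omega> *
            (ennreal (exp (- l * u)) * indicator {s k..} u * f (x + X u \<omega>)) \<partial>lborel \<partial>M)
       = ennreal (exp (- l * s k)) *
          (\<integral>\<^sup>+\<omega>. indicator {\<omega>. \<forall>j\<le>k. X (s j) \<omega> \<in> B j} \<omega> * occ l {0..} f (x + X (s k) \<omega>) \<partial>M)"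
proof -
  interpret pair_sigma_finite lborel M ..
  define A where "A = {\<omega> \<in> space M. \<forall>j\<le>k. X (s j) \<omega> \<in> B j}"
  have [measurable]: "A \<in> sets M"
  proof -
    have "(\<Inter>j\<in>{..k}. X (s j) -` B j \<inter> space M) \<in> sets M"
      by (intro sets.finite_INT measurable_sets[OF X_measurable]) auto
    also have "(\<Inter>j\<in>{..k}. X (s j) -` B j \<inter> space M) = A"
      by (auto simp: A_def)
    finally show ?thesis .
  qed
  have A: "indicator {\<omega>. \<forall>j\<le>k. X (s j) \<omega> \<in> B j} \<omega> = (indicator A \<omega> :: ennreal)" if "\<omega> \<in> space M" for \<omega>
    using that by (auto simp: A_def split: split_indicator)
  have mk: "(\<integral>\<^sup>+\<omega>. indicator A \<omega> * f (x + X (s k + v) \<omega>) \<partial>M)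
      = (\<integral>\<^sup>+\<omega>. indicator A \<omega> * (\<integral>\<^sup>+\<omega>'. f (x + X (s k) \<omega> + X v \<omega>') \<partial>M) \<partial>M)" if "0 \<le> v" for v
    using markov[where k=k and s=s and B=B and F="\<lambda>z y. f (x + z + y)", OF s0 mono that B]
    by (simp add: A cong: nn_integral_cong)
  let ?e = "\<lambda>u. ennreal (exp (- l * u))"
  have "(\<integral>\<^sup>+\<omega>. \<integral>\<^sup>+u. indicator {\<omega>. \<forall>j\<le>k. X (s j) \<omega> \<in> B j} \<omega> *
            (?e u * indicator {s k..} u * f (x + X u \<omega>)) \<partial>lborel \<partial>M)
    = (\<integral>\<^sup>+\<omega>. \<integral>\<^sup>+u. indicator A \<omega> * (?e u * indicator {s k..} u * f (x + X u \<omega>)) \<partial>lborel \<partial>M)"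
    by (simp add: A cong: nn_integral_cong)
  also have "\<dots> = (\<integral>\<^sup>+u. \<integral>\<^sup>+\<omega>. indicator A \<omega> * (?e u * indicator {s k..} u * f (x + X u \<omega>)) \<partial>M \<partial>lborel)"
    by (rule Fubini') measurable
  also have "\<dots> = (\<integral>\<^sup>+u. ?e u * indicator {s k..} u * (\<integral>\<^sup>+\<omega>. indicator A \<omega> * f (x + X u \<omega>) \<partial>M) \<partial>lborel)"
    by (subst nn_integral_cmult[symmetric]) (auto simp: mult_ac)
  also have "\<dots> = (\<integral>\<^sup>+v. ?e (s k + v) * indicator {s k..} (s k + v) * (\<integral>\<^sup>+\<omega>. indicator A \<omega> * f (x + X (s k + v) \<omega>) \<partial>M) \<partial>lborel)"
    by (subst nn_integral_real_affine[where c=1 and t="s k"]) auto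
  also have "\<dots> = (\<integral>\<^sup>+v. ?e (s k) * (\<integral>\<^sup>+\<omega>. indicator A \<omega> * (?e v * indicator {0..} v * (\<integral>\<^sup>+\<omega>'. f (x + X (s k) \<omega> + X v \<omega>') \<partial>M)) \<partial>M) \<partial>lborel)"
  proof (rule nn_integral_cong)
    fix v :: real
    have e: "?e (s k + v) = ?e (s k) * ?e v"
      by (simp add: ennreal_mult[symmetric] exp_add[symmetric] algebra_simps)
    show "?e (s k + v) * indicator {s k..} (s k + v) * (\<integral>\<^sup>+\<omega>. indicator A \<omega> * f (x + X (s k + v) \<omega>) \<partial>M)
      = ?e (s k) * (\<integral>\<^sup>+\<omega>. indicator A \<omega> * (?e v * indicator {0..} v * (\<integral>\<^sup>+\<omega>'. f (x + X (s k) \<omega> + X v \<omega>') \<partial>M)) \<partial>M)"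
    proof (cases "0 \<le> v")
      case True
      have "(\<integral>\<^sup>+\<omega>. indicator A \<omega> * (?e v * (\<integral>\<^sup>+\<omega>'. f (x + X (s k) \<omega> + X v \<omega>') \<partial>M)) \<partial>M)
          = ?e v * (\<integral>\<^sup>+\<omega>. indicator A \<omega> * (\<integral>\<^sup>+\<omega>'. f (x + X (s k) \<omega> + X v \<omega>') \<partial>M) \<partial>M)"
        by (subst nn_integral_cmult[symmetric]) (auto simp: mult_ac)
      with True show ?thesis unfolding e
        by (simp add: mk mult_ac)
    qed auto
  qed
  also have "\<dots> = ?e (s k) * (\<integral>\<^sup>+v. (\<integral>\<^sup>+\<omega>. indicator A \<omega> * (?e v * indicator {0..} v * (\<integral>\<^sup>+\<omega>'. f (x + X (s k) \<omega> + X v \<omega>') \<partial>M)) \<partial>M) \<partial>lborel)"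
    by (rule nn_integral_cmult) measurable
  also have "(\<integral>\<^sup>+v. (\<integral>\<^sup>+\<omega>. indicator A \<omega> * (?e v * indicator {0..} v * (\<integral>\<^sup>+\<omega>'. f (x + X (s k) \<omega> + X v \<omega>') \<partial>M)) \<partial>M) \<partial>lborel)
      = (\<integral>\<^sup>+\<omega>. (\<integral>\<^sup>+v. indicator A \<omega> * (?e v * indicator {0..} v * (\<integral>\<^sup>+\<omega>'. f (x + X (s k) \<omega> + X v \<omega>') \<partial>M)) \<partial>lborel) \<partial>M)"
    by (rule Fubini'[symmetric]) measurable
  also have "\<dots> = (\<integral>\<^sup>+\<omega>. indicator A \<omega> * occ l {0..} f (x + X (s k) \<omega>) \<partial>M)"
    by (simp add: occ_eq_integral_time nn_integral_cmult)
  also have "\<dots> = (\<integral>\<^sup>+\<omega>. indicator {\<omega>. \<forall>j\<le>k. X (s j) \<omega> \<in> B j} \<omega> * occ l {0..} f (x + X (s k) \<omega>) \<partial>M)"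
    by (simp add: A cong: nn_integral_cong)
  finally show ?thesis .
qed

lemma occ_after:
  assumes "0 \<le> t" and [measurable]: "f \<in> borel_measurable borel"
  shows "occ l {t..} f x = ennreal (exp (- l * t)) * (\<integral>\<^sup>+\<omega>. occ l {0..} f (x + X t \<omega>) \<partial>M)"
  using markov_occ[of "\<lambda>_. t" 0 "\<lambda>_. UNIV" f l x] assms by (simp add: occ_def)

section \<open>Entrance into open sets\<close>

text \<open>The window is half-open so that, by right-continuity, a hit of an open set persists to
  later times still inside it; rational times or fine grids then detect it.\<close>

definition hits :: "'a \<Rightarrow> 'a set \<Rightarrow> real \<Rightarrow> real \<Rightarrow> 'w set" where
  "hits x V t h = {\<omega> \<in> space M. \<exists>u\<in>{t..<h}. x + X u \<omega> \<in> V}"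

lemma eventually_in_open:
  assumes "open V" "x + X u \<omega> \<in> V"
  shows "\<exists>b>u. \<forall>y. u < y \<and> y < b \<longrightarrow> x + X y \<omega> \<in> V"
proof -
  have "((\<lambda>s. x + X s \<omega>) \<longlongrightarrow> x + X u \<omega>) (at_right u)"
    by (intro tendsto_intros X_rc)
  from topological_tendstoD[OF this assms] show ?thesis
    by (auto simp: eventually_at_right_field)
qed

lemma hits_sets[measurable]:
  assumes V: "open V" shows "hits x V t h \<in> sets M"
proof -
  have "hits x V t h = (\<Union>q\<in>\<rat> \<inter> {t..<h}. (\<lambda>\<omega>. x + X q \<omega>) -` V \<inter> space M)"
  proof (intro equalityI subsetI)
    fix \<omega> assume "\<omega> \<in> hits x V t h"
    then obtain u where u: "\<omega> \<in> space M" "t \<le> u" "u < h" "x + X u \<omega> \<in> V" by (auto simp: hits_def)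
    from eventually_in_open[OF V u(4)] obtain b where b: "u < b" "\<And>y. u < y \<and> y < b \<Longrightarrow> x + X y \<omega> \<in> V"
      by auto
    have "u < min b h" using b u by auto
    then obtain q where "q \<in> \<rat>" "u < q" "q < min b h" using Rats_dense_in_real by blast
    then show "\<omega> \<in> (\<Union>q\<in>\<rat> \<inter> {t..<h}. (\<lambda>\<omega>. x + X q \<omega>) -` V \<inter> space M)"
      using b u by (auto intro!: bexI[of _ q])
  qed (auto simp: hits_def)
  also have "\<dots> \<in> sets M"
  proof (rule sets.countable_UN'')
    show "(\<lambda>\<omega>. x + X q \<omega>) -` V \<inter> space M \<in> sets M" for q
      by (rule measurable_sets[where A=borel]) (use V in auto)
    show "countable (\<rat> \<inter> {t..<h})" using countable_rat by blast
  qed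
  finally show ?thesis .
qed

lemma hits_mono: "V \<subseteq> V' \<Longrightarrow> t' \<le> t \<Longrightarrow> h \<le> h' \<Longrightarrow> hits x V t h \<subseteq> hits x V' t' h'"
  by (force simp: hits_def)

lemma grid_hit:
  assumes "open V" "x + X u \<omega> \<in> V" "t \<le> u" "u < h"
  shows "\<forall>\<^sub>F m in sequentially. \<exists>k. u < t + real k * (1 / real (Suc m)) \<and>
    t + real k * (1 / real (Suc m)) < h \<and> x + X (t + real k * (1 / real (Suc m))) \<omega> \<in> V"
proof -
  from eventually_in_open[OF assms(1,2)] obtain b
    where b: "u < b" "\<And>y. u < y \<and> y < b \<Longrightarrow> x + X y \<omega> \<in> V" by auto
  have "(\<lambda>m. 1 / real (Suc m)) \<longlonglongrightarrow> 0" by (rule LIMSEQ_Suc[OF lim_1_over_n])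
  then have "\<forall>\<^sub>F m in sequentially. 1 / real (Suc m) < min b h - u"
    using b assms by (intro order_tendstoD) auto
  then show ?thesis
  proof eventually_elim
    case (elim m)
    define d where "d = 1 / real (Suc m)"
    have d: "d > 0" "d < min b h - u" using elim by (auto simp: d_def)
    \<comment> \<open>The first grid point strictly beyond \<open>u\<close>; it overshoots by at
      most \<open>d\<close>, hence stays below \<open>min b h\<close>.\<close>
    define k where "k = nat (\<lfloor>(u - t) / d\<rfloor> + 1)"
    have k: "real k = of_int \<lfloor>(u - t) / d\<rfloor> + 1"
      using assms d by (simp add: k_def)
    have "(u - t) / d < real k" "real k \<le> (u - t) / d + 1" unfolding k by linarith+
    then have "u < t + real k * d" "t + real k * d \<le> u + d"
      using d by (auto simp: field_simps)
    then have "u < t + real k * d \<and> t + real k * d < h \<and> x + X (t + real k * d) \<omega> \<in> V"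
      using d b(2)[of "t + real k * d"] by auto
    then show ?case unfolding d_def by blast
  qed
qed

text \<open>
  \<open>entry x V t d k\<close> says that \<open>k\<close> is the first index at which the process started at \<open>x\<close> and observed
  only at the times \<open>t, t + d, t + 2d, \<dots>\<close> is in \<open>V\<close>. Since \<open>V\<close> is open and paths are right-continuous,
  letting \<open>d\<close> tend to \<open>0\<close> recovers the entrance time; at a grid entrance the process lies in \<open>V\<close>
  itself and not merely in its closure.
\<close>

definition entry :: "'a \<Rightarrow> 'a set \<Rightarrow> real \<Rightarrow> real \<Rightarrow> nat \<Rightarrow> 'w set" where
  "entry x V t d k = {\<omega> \<in> space M. x + X (t + real k * d) \<omega> \<in> V \<and> (\<forall>j<k. x + X (t + real j * d) \<omega> \<notin> V)}"

lemma entry_sets[measurable]: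
  assumes [measurable]: "V \<in> sets borel" shows "entry x V t d k \<in> sets M"
proof -
  let ?H = "\<lambda>j. (\<lambda>\<omega>. x + X (t + real j * d) \<omega>) -` V \<inter> space M"
  have H: "?H j \<in> sets M" for j
    by (rule measurable_sets[where A=borel]) measurable
  have "?H k - (\<Union>j<k. ?H j) \<in> sets M"
    using H by (intro sets.Diff sets.finite_UN) blast+
  also have "?H k - (\<Union>j<k. ?H j) = entry x V t d k"
    by (auto simp: entry_def)
  finally show ?thesis .
qed

lemma entry_unique: "\<omega> \<in> entry x V t d k \<Longrightarrow> \<omega> \<in> entry x V t d k' \<Longrightarrow> k = k'"
  by (cases k k' rule: linorder_cases) (auto simp: entry_def)

lemma entry_exists:
  assumes "\<omega> \<in> space M" "x + X (t + real k * d) \<omega> \<in> V"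
  obtains k' where "k' \<le> k" "\<omega> \<in> entry x V t d k'"
proof -
  define k' where "k' = (LEAST k. x + X (t + real k * d) \<omega> \<in> V)"
  have "x + X (t + real k' * d) \<omega> \<in> V" unfolding k'_def using assms(2) by (rule LeastI)
  moreover have "k' \<le> k" unfolding k'_def using assms(2) by (rule Least_le)
  moreover have "x + X (t + real j * d) \<omega> \<notin> V" if "j < k'" for j
    using not_less_Least that unfolding k'_def by blast
  ultimately show ?thesis using assms(1) by (intro that[of k']) (auto simp: entry_def)
qed

text \<open>The events are disjoint in \<open>k\<close>, so this series encodes a quantity evaluated
  at the grid entrance, with value \<open>0\<close> on paths that the grid never catches in
  \<open>V\<close>.\<close>

lemma suminf_entry:
  fixes g :: "nat \<Rightarrow> ennreal"
  shows "\<omega> \<in> entry x V t d k \<Longrightarrow> (\<Sum>j. indicator (entry x V t d j) \<omega> * g j) = g k"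
    and "(\<And>k. \<omega> \<notin> entry x V t d k) \<Longrightarrow> (\<Sum>j. indicator (entry x V t d j) \<omega> * g j) = 0"
proof -
  assume k: "\<omega> \<in> entry x V t d k"
  have "(\<Sum>j. indicator (entry x V t d j) \<omega> * g j) = indicator (entry x V t d k) \<omega> * g k"
  proof (rule suminf_subsingleton)
    fix j assume "indicator (entry x V t d j) \<omega> * g j \<noteq> 0"
    then have "\<omega> \<in> entry x V t d j" by (auto split: split_indicator_asm)
    then show "j = k" using k by (rule entry_unique)
  qed
  with k show "(\<Sum>j. indicator (entry x V t d j) \<omega> * g j) = g k" by simp
qed simp

text \<open>Being outside \<open>V\<close> before step \<open>k\<close> and inside at step
  \<open>k\<close> is a product condition, the form in which \<open>markov\<close> takes the
  past.\<close>

lemma entry_cylinder: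
  assumes [measurable]: "V \<in> sets borel"
  obtains B where "\<And>j. B j \<in> sets borel"
    "\<And>\<omega>. \<omega> \<in> space M \<Longrightarrow> indicator {\<omega>. \<forall>j\<le>k. X (t + real j * d) \<omega> \<in> B j} \<omega> = (indicator (entry x V t d k) \<omega> :: ennreal)"
proof
  define B where "B j = (\<lambda>z. x + z) -` (if j < k then - V else V)" for j
  show "B j \<in> sets borel" for j
    unfolding B_def using measurable_sets[of "\<lambda>z. x + z" borel borel "if j < k then - V else V"]
    by auto
  show "indicator {\<omega>. \<forall>j\<le>k. X (t + real j * d) \<omega> \<in> B j} \<omega> = (indicator (entry x V t d k) \<omega> :: ennreal)"
    if "\<omega> \<in> space M" for \<omega>
    using that by (auto simp: entry_def B_def split: split_indicator if_splits)
qed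

text \<open>The grid entrance time has countably many values, so summing \<open>markov_occ\<close>
  over them is all that the strong Markov property requires here.\<close>

lemma entry_strong_markov:
  assumes t: "0 \<le> t" and d: "0 \<le> d" and [measurable]: "V \<in> sets borel" "f \<in> borel_measurable borel"
  shows "(\<integral>\<^sup>+\<omega>. \<integral>\<^sup>+u. (\<Sum>k. indicator (entry x V t d k) \<omega> *
            (ennreal (exp (- l * u)) * indicator {t + real k * d..} u * f (x + X u \<omega>))) \<partial>lborel \<partial>M)
       = (\<Sum>k. ennreal (exp (- l * (t + real k * d))) *
            (\<integral>\<^sup>+\<omega>. indicator (entry x V t d k) \<omega> * occ l {0..} f (x + X (t + real k * d) \<omega>) \<partial>M))"
proof -
  have "(\<integral>\<^sup>+\<omega>. \<integral>\<^sup>+u. indicator (entry x V t d k) \<omega> *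
            (ennreal (exp (- l * u)) * indicator {t + real k * d..} u * f (x + X u \<omega>)) \<partial>lborel \<partial>M)
       = ennreal (exp (- l * (t + real k * d))) *
            (\<integral>\<^sup>+\<omega>. indicator (entry x V t d k) \<omega> * occ l {0..} f (x + X (t + real k * d) \<omega>) \<partial>M)" for k
  proof -
    obtain B where [measurable]: "\<And>j. B j \<in> sets borel"
      and B: "\<And>\<omega>. \<omega> \<in> space M \<Longrightarrow> indicator {\<omega>. \<forall>j\<le>k. X (t + real j * d) \<omega> \<in> B j} \<omega> = (indicator (entry x V t d k) \<omega> :: ennreal)"
      using entry_cylinder[of V k t d x] by auto
    have mono: "t + real i * d \<le> t + real (Suc i) * d" for i
      using d by (simp add: algebra_simps)
    show ?thesis
      using markov_occ[of "\<lambda>k. t + real k * d" k B f l x] t mono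
      by (simp add: B cong: nn_integral_cong)
  qed
  then show ?thesis by (simp add: nn_integral_suminf)
qed

text \<open>Nothing accumulates in \<open>V\<close> before the entrance time \<open>T\<close> after
  \<open>t\<close>, and the factor in parentheses bounds the expected discount at \<open>T\<close>:
  at most \<open>1\<close> if \<open>T < h\<close>, at most \<open>exp (- l * h)\<close> otherwise.
  The estimate is proved on grids and carried over by Fatou.\<close>

lemma occ_le_hits:
  assumes t: "0 \<le> t" and l: "0 \<le> l" and V: "open V" and f[measurable]: "f \<in> borel_measurable borel"
    and C: "\<And>y. y \<in> V \<Longrightarrow> occ l {0..} f y \<le> C"
  shows "occ l {t..} (\<lambda>y. indicator V y * f y) x
    \<le> C * (emeasure M (hits x V t h) + ennreal (exp (- l * h)) * emeasure M (space M - hits x V t h))"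
proof -
  have [measurable]: "V \<in> sets borel" "hits x V t h \<in> sets M" using V by auto
  let ?d = "\<lambda>m. 1 / real (Suc m)"
  let ?e = "\<lambda>u. ennreal (exp (- l * u))"
  \<comment> \<open>The discounted integrand of \<open>f\<close>, switched on at the entrance seen
    by the grid of mesh \<open>?d m\<close>.\<close>
  define S where "S m \<omega> u = (\<Sum>k. indicator (entry x V t (?d m) k) \<omega> *
      (?e u * indicator {t + real k * ?d m..} u * f (x + X u \<omega>)))" for m \<omega> u
  have [measurable]: "(\<lambda>u. S m \<omega> u) \<in> borel_measurable borel" for m \<omega>
    unfolding S_def by measurable
  have [measurable]: "(\<lambda>\<omega>. \<integral>\<^sup>+u. S m \<omega> u \<partial>lborel) \<in> borel_measurable M" for m
    unfolding S_def by measurable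
  have path: "(\<integral>\<^sup>+u. ?e u * indicator {t..} u * (indicator V (x + X u \<omega>) * f (x + X u \<omega>)) \<partial>lborel)
      \<le> liminf (\<lambda>m. \<integral>\<^sup>+u. S m \<omega> u \<partial>lborel)" if \<omega>: "\<omega> \<in> space M" for \<omega>
  proof -
    define H where "H = {u. t \<le> u \<and> x + X u \<omega> \<in> V}"
    \<comment> \<open>At the entrance time itself no grid time need have hit \<open>V\<close> yet, but one instant is a null set.\<close>
    have *: "?e u * indicator {t..} u * (indicator V (x + X u \<omega>) * f (x + X u \<omega>)) \<le> liminf (\<lambda>m. S m \<omega> u)"
      if u: "u \<noteq> Inf H" for u
    proof (cases "u \<in> H")
      case True
      have bdd: "bdd_below H" by (auto simp: H_def bdd_below_def)
      have "Inf H < u" using cInf_lower[OF True bdd] u by simp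
      then obtain v where v: "v \<in> H" "v < u"
        using True bdd by (subst (asm) cInf_less_iff) auto
      have "\<forall>\<^sub>F m in sequentially. \<exists>k. t + real k * ?d m < u \<and> x + X (t + real k * ?d m) \<omega> \<in> V"
        using grid_hit[OF V, of x v \<omega> t u] v by (force simp: H_def elim: eventually_mono)
      then have "\<forall>\<^sub>F m in sequentially. ?e u * f (x + X u \<omega>) \<le> S m \<omega> u"
      proof eventually_elim
        case (elim m)
        then obtain k where k: "t + real k * ?d m < u" "x + X (t + real k * ?d m) \<omega> \<in> V" by auto
        obtain k' where k': "k' \<le> k" "\<omega> \<in> entry x V t (?d m) k'"
          using entry_exists[OF \<omega> k(2)] .
        have "real k' * ?d m \<le> real k * ?d m" using k' by (intro mult_right_mono) auto
        then have "t + real k' * ?d m \<le> u" using k(1) by linarith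
        then show ?case unfolding S_def suminf_entry(1)[OF k'(2)] by simp
      qed
      then have "?e u * f (x + X u \<omega>) \<le> liminf (\<lambda>m. S m \<omega> u)" by (rule Liminf_bounded)
      with True show ?thesis by (auto simp: H_def)
    qed (auto simp: H_def split: split_indicator)
    have "(\<integral>\<^sup>+u. ?e u * indicator {t..} u * (indicator V (x + X u \<omega>) * f (x + X u \<omega>)) \<partial>lborel)
      \<le> (\<integral>\<^sup>+u. liminf (\<lambda>m. S m \<omega> u) \<partial>lborel)"
      by (intro nn_integral_mono_AE eventually_mono[OF AE_lborel_singleton[of "Inf H"]] *)
    also have "\<dots> \<le> liminf (\<lambda>m. \<integral>\<^sup>+u. S m \<omega> u \<partial>lborel)"
      by (rule nn_integral_liminf) measurable
    finally show ?thesis .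
  qed
  have bound: "(\<integral>\<^sup>+\<omega>. \<integral>\<^sup>+u. S m \<omega> u \<partial>lborel \<partial>M)
      \<le> C * (emeasure M (hits x V t h) + ?e h * emeasure M (space M - hits x V t h))" for m
  proof -
    let ?s = "\<lambda>k. t + real k * ?d m"
    have "(\<integral>\<^sup>+\<omega>. \<integral>\<^sup>+u. S m \<omega> u \<partial>lborel \<partial>M)
      = (\<Sum>k. ?e (?s k) * (\<integral>\<^sup>+\<omega>. indicator (entry x V t (?d m) k) \<omega> * occ l {0..} f (x + X (?s k) \<omega>) \<partial>M))"
      unfolding S_def by (rule entry_strong_markov) (use t in auto)
    also have "\<dots> \<le> (\<Sum>k. ?e (?s k) * (\<integral>\<^sup>+\<omega>. indicator (entry x V t (?d m) k) \<omega> * C \<partial>M))"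
      by (intro suminf_le summableI, rule mult_left_mono, rule nn_integral_mono, rule indicator_mult_mono)
         (auto simp: entry_def simp del: of_nat_Suc intro!: C)
    also have "\<dots> = (\<Sum>k. (\<integral>\<^sup>+\<omega>. indicator (entry x V t (?d m) k) \<omega> * (?e (?s k) * C) \<partial>M))"
      by (subst nn_integral_cmult[symmetric]) (auto simp: mult_ac)
    also have "\<dots> = (\<integral>\<^sup>+\<omega>. (\<Sum>k. indicator (entry x V t (?d m) k) \<omega> * (?e (?s k) * C)) \<partial>M)"
      by (subst nn_integral_suminf) auto
    also have "\<dots> \<le> (\<integral>\<^sup>+\<omega>. C * (indicator (hits x V t h) \<omega> + ?e h * indicator (space M - hits x V t h) \<omega>) \<partial>M)"
    proof (rule nn_integral_mono)
      fix \<omega> assume \<omega>: "\<omega> \<in> space M"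
      show "(\<Sum>k. indicator (entry x V t (?d m) k) \<omega> * (?e (?s k) * C))
         \<le> C * (indicator (hits x V t h) \<omega> + ?e h * indicator (space M - hits x V t h) \<omega>)"
      proof (cases "\<exists>k. \<omega> \<in> entry x V t (?d m) k")
        case True
        then obtain k where k: "\<omega> \<in> entry x V t (?d m) k" by auto
        \<comment> \<open>A path that hits before \<open>h\<close> may be noticed by the grid only
          after \<open>h\<close>; the trivial bound \<open>1\<close> covers this too.\<close>
        have "?e (?s k) \<le> indicator (hits x V t h) \<omega> + ?e h * indicator (space M - hits x V t h) \<omega>"
        proof (cases "\<omega> \<in> hits x V t h")
          case True
          have "0 \<le> ?s k" using t by auto
          with l True show ?thesis by (simp del: of_nat_Suc)
        next
          case False
          have "h \<le> ?s k"
          proof (rule ccontr)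
            assume "\<not> ?thesis"
            then have "\<omega> \<in> hits x V t h"
              using k \<omega> unfolding hits_def entry_def by (auto intro!: bexI[of _ "?s k"])
            with False show False by simp
          qed
          then show ?thesis using False \<omega> l by (simp add: mult_left_mono del: of_nat_Suc)
        qed
        then show ?thesis unfolding suminf_entry(1)[OF k]
          by (subst mult.commute) (rule mult_left_mono, auto)
      qed (simp add: suminf_entry(2))
    qed
    also have "\<dots> = C * (emeasure M (hits x V t h) + ?e h * emeasure M (space M - hits x V t h))"
      by (simp add: nn_integral_cmult nn_integral_add)
    finally show ?thesis .
  qed
  have "occ l {t..} (\<lambda>y. indicator V y * f y) x \<le> (\<integral>\<^sup>+\<omega>. liminf (\<lambda>m. \<integral>\<^sup>+u. S m \<omega> u \<partial>lborel) \<partial>M)"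
    unfolding occ_def by (intro nn_integral_mono path)
  also have "\<dots> \<le> liminf (\<lambda>m. \<integral>\<^sup>+\<omega>. \<integral>\<^sup>+u. S m \<omega> u \<partial>lborel \<partial>M)"
    by (rule nn_integral_liminf) measurable
  also have "\<dots> \<le> C * (emeasure M (hits x V t h) + ?e h * emeasure M (space M - hits x V t h))"
    using bound by (intro Liminf_le always_eventually) auto
  finally show ?thesis .
qed

text \<open>Restarting at a grid entrance never collects more than the whole potential after
  \<open>t\<close>, whatever the mesh. Fatou enters only through the discount: a path hitting before
  \<open>h\<close> is caught before \<open>h\<close> by all fine grids.\<close>

lemma occ_ge_hits:
  assumes t: "0 \<le> t" and l: "0 \<le> l" and V: "open V" and f[measurable]: "f \<in> borel_measurable borel"
    and C: "\<And>y. y \<in> V \<Longrightarrow> C \<le> occ l {0..} f y"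
  shows "C * (ennreal (exp (- l * h)) * emeasure M (hits x V t h)) \<le> occ l {t..} f x"
proof -
  have [measurable]: "V \<in> sets borel" "hits x V t h \<in> sets M" using V by auto
  let ?d = "\<lambda>m. 1 / real (Suc m)"
  let ?e = "\<lambda>u. ennreal (exp (- l * u))"
  define T where "T m \<omega> = (\<Sum>k. indicator (entry x V t (?d m) k) \<omega> * (C * ?e (t + real k * ?d m)))" for m \<omega>
  have [measurable]: "T m \<in> borel_measurable M" for m unfolding T_def by measurable
  have bound: "(\<integral>\<^sup>+\<omega>. T m \<omega> \<partial>M) \<le> occ l {t..} f x" for m
  proof -
    let ?s = "\<lambda>k. t + real k * ?d m"
    have "(\<integral>\<^sup>+\<omega>. T m \<omega> \<partial>M) = (\<Sum>k. (\<integral>\<^sup>+\<omega>. indicator (entry x V t (?d m) k) \<omega> * (C * ?e (?s k)) \<partial>M))"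
      unfolding T_def by (subst nn_integral_suminf) auto
    also have "\<dots> = (\<Sum>k. ?e (?s k) * (\<integral>\<^sup>+\<omega>. indicator (entry x V t (?d m) k) \<omega> * C \<partial>M))"
      by (subst nn_integral_cmult[symmetric]) (auto simp: mult_ac)
    also have "\<dots> \<le> (\<Sum>k. ?e (?s k) * (\<integral>\<^sup>+\<omega>. indicator (entry x V t (?d m) k) \<omega> * occ l {0..} f (x + X (?s k) \<omega>) \<partial>M))"
      by (intro suminf_le summableI, rule mult_left_mono, rule nn_integral_mono, rule indicator_mult_mono)
         (auto simp: entry_def simp del: of_nat_Suc intro!: C)
    also have "\<dots> = (\<integral>\<^sup>+\<omega>. \<integral>\<^sup>+u. (\<Sum>k. indicator (entry x V t (?d m) k) \<omega> *
            (?e u * indicator {?s k..} u * f (x + X u \<omega>))) \<partial>lborel \<partial>M)"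
      by (rule entry_strong_markov[symmetric]) (use t in auto)
    also have "\<dots> \<le> occ l {t..} f x"
      unfolding occ_def
    proof (intro nn_integral_mono)
      fix \<omega> u
      show "(\<Sum>k. indicator (entry x V t (?d m) k) \<omega> * (?e u * indicator {?s k..} u * f (x + X u \<omega>)))
         \<le> ?e u * indicator {t..} u * f (x + X u \<omega>)"
      proof (cases "\<exists>k. \<omega> \<in> entry x V t (?d m) k")
        case True
        then obtain k where k: "\<omega> \<in> entry x V t (?d m) k" by auto
        have "indicator {?s k..} u \<le> (indicator {t..} u :: ennreal)"
        proof (rule indicator_leI)
          have "t \<le> ?s k" by simp
          then show "u \<in> {?s k..} \<Longrightarrow> u \<in> {t..}" unfolding atLeast_iff by (rule order_trans)
        qed
        then show ?thesis unfolding suminf_entry(1)[OF k] by (intro mult_mono) auto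
      qed (simp add: suminf_entry(2))
    qed
    finally show ?thesis .
  qed
  have "C * (?e h * emeasure M (hits x V t h)) = (\<integral>\<^sup>+\<omega>. C * (?e h * indicator (hits x V t h) \<omega>) \<partial>M)"
    by (simp add: nn_integral_cmult)
  also have "\<dots> \<le> (\<integral>\<^sup>+\<omega>. liminf (\<lambda>m. T m \<omega>) \<partial>M)"
  proof (intro nn_integral_mono)
    fix \<omega> assume \<omega>: "\<omega> \<in> space M"
    show "C * (?e h * indicator (hits x V t h) \<omega>) \<le> liminf (\<lambda>m. T m \<omega>)"
    proof (cases "\<omega> \<in> hits x V t h")
      case True
      then obtain u where u: "t \<le> u" "u < h" "x + X u \<omega> \<in> V" by (auto simp: hits_def)
      from grid_hit[OF V u(3,1,2)] have "\<forall>\<^sub>F m in sequentially. C * ?e h \<le> T m \<omega>"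
      proof eventually_elim
        case (elim m)
        then obtain k where k: "t + real k * ?d m < h" "x + X (t + real k * ?d m) \<omega> \<in> V" by auto
        obtain k' where k': "k' \<le> k" "\<omega> \<in> entry x V t (?d m) k'"
          using entry_exists[OF \<omega> k(2)] .
        have "real k' * ?d m \<le> real k * ?d m" using k' by (intro mult_right_mono) auto
        then have "t + real k' * ?d m \<le> h" using k(1) by linarith
        then show ?case unfolding T_def suminf_entry(1)[OF k'(2)]
          using l by (intro mult_left_mono) (auto intro!: ennreal_leI mult_left_mono simp del: of_nat_Suc)
      qed
      then have "C * ?e h \<le> liminf (\<lambda>m. T m \<omega>)" by (rule Liminf_bounded)
      with True show ?thesis by simp
    qed simp
  qed
  also have "\<dots> \<le> liminf (\<lambda>m. \<integral>\<^sup>+\<omega>. T m \<omega> \<partial>M)"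
    by (rule nn_integral_liminf) measurable
  also have "\<dots> \<le> occ l {t..} f x"
    using bound by (intro Liminf_le always_eventually) auto
  finally show ?thesis .
qed

section \<open>The two smallness conditions\<close>

text \<open>At a positive rate truncated functions have bounded potentials, so
  \<open>ennreal_le_contraction\<close> applies to them; a bound free of \<open>N\<close> survives
  by monotone convergence.\<close>

lemma occ_le_truncated:
  assumes f[measurable]: "f \<in> borel_measurable borel" and I[measurable]: "I \<in> sets borel"
    and le: "\<And>N::nat. occ l I (\<lambda>y. min (f y) (of_nat N)) x \<le> D"
  shows "occ l I f x \<le> D"
proof -
  have "occ l I f x = occ l I (\<lambda>y. SUP N. min (f y) (of_nat N)) x" by (simp add: SUP_min_of_nat)
  also have "\<dots> = (SUP N. occ l I (\<lambda>y. min (f y) (of_nat N)) x)"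
    by (rule occ_SUP) (auto simp: incseq_def le_fun_def intro: min.coboundedI2)
  also have "\<dots> \<le> D" using le by (auto intro: SUP_least)
  finally show ?thesis .
qed

text \<open>The Markov property at time \<open>t\<close> gives
  \<open>S \<le> C + exp (- l * t) * S\<close> for the supremum \<open>S\<close> of the potential;
  the constant is the geometric series.\<close>

lemma occ_le_of_initial:
  assumes f[measurable]: "f \<in> borel_measurable borel" and l: "0 < l" and t: "0 < t"
    and C: "\<And>x. occ l {0..<t} f x \<le> C"
  shows "occ l {0..} f x \<le> C * ennreal (1 / (1 - exp (- l * t)))"
proof (rule occ_le_truncated[OF f])
  fix N :: nat
  define g where "g y = min (f y) (of_nat N)" for y
  have [measurable]: "g \<in> borel_measurable borel" unfolding g_def by measurable
  define S where "S = (SUP x. occ l {0..} g x)"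
  have "g y \<le> ennreal (real N)" for y by (auto simp: g_def ennreal_of_nat_eq_real_of_nat)
  then have "occ l {0..} g x \<le> occ l {0..} (\<lambda>y. ennreal (real N)) x" for x by (intro occ_mono) auto
  then have "S \<le> ennreal (real N) * ennreal (1 / l)" using l unfolding S_def by (auto simp: occ_const intro: SUP_least)
  then have fin: "S < \<infinity>" by (rule order.strict_trans1) (auto simp: ennreal_mult_less_top)
  have "occ l {0..} g x \<le> C + ennreal (exp (- l * t)) * S" for x
  proof -
    have "occ l {0..} g x = occ l {0..<t} g x + occ l {t..} g x" using t by (intro occ_split) auto
    also have "\<dots> \<le> C + ennreal (exp (- l * t)) * S"
    proof (intro add_mono)
      have "occ l {0..<t} g x \<le> occ l {0..<t} f x" by (intro occ_mono) (auto simp: g_def)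
      then show "occ l {0..<t} g x \<le> C" using C order_trans by blast
      have "(\<integral>\<^sup>+\<omega>. occ l {0..} g (x + X t \<omega>) \<partial>M) \<le> (\<integral>\<^sup>+\<omega>. S \<partial>M)"
        unfolding S_def by (intro nn_integral_mono SUP_upper) auto
      then show "occ l {t..} g x \<le> ennreal (exp (- l * t)) * S"
        using t by (subst occ_after) (auto intro!: mult_left_mono simp: emeasure_space_1)
    qed
    finally show ?thesis .
  qed
  then have "S \<le> C + ennreal (exp (- l * t)) * S" by (auto simp: S_def intro: SUP_least)
  from ennreal_le_contraction[OF this fin] have "S \<le> C * ennreal (1 / (1 - exp (- l * t)))"
    using l t by auto
  then show "occ l {0..} (\<lambda>y. min (f y) (of_nat N)) x \<le> C * ennreal (1 / (1 - exp (- l * t)))"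
    unfolding g_def[symmetric] by (rule order_trans[rotated]) (auto simp: S_def intro: SUP_upper)
qed auto

text \<open>Nothing accumulates before the entrance into \<open>V\<close>. This is
  \<open>occ_le_hits\<close> with the empty window \<open>t = h = 0\<close>, where the discount
  bound is simply \<open>1\<close>.\<close>

lemma maximum_principle:
  assumes l: "0 \<le> l" and V: "open V" and f[measurable]: "f \<in> borel_measurable borel"
    and C: "\<And>y. y \<in> V \<Longrightarrow> occ l {0..} (\<lambda>y. indicator V y * f y) y \<le> C"
  shows "occ l {0..} (\<lambda>y. indicator V y * f y) x \<le> C"
proof -
  have [measurable]: "V \<in> sets borel" using V by auto
  have "hits x V 0 0 = {}" by (auto simp: hits_def)
  moreover have "(\<lambda>y. indicator V y * (indicator V y * f y)) = (\<lambda>y. indicator V y * f y)"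
    by (auto simp: fun_eq_iff split: split_indicator)
  ultimately show ?thesis
    using occ_le_hits[of 0 l V "\<lambda>y. indicator V y * f y" C x 0] assms by (simp add: emeasure_space_1)
qed

lemma hits_shift:
  "(\<And>u. x + u \<in> V \<Longrightarrow> u \<in> W) \<Longrightarrow> hits x V t h \<subseteq> hits 0 W t h"
  by (force simp: hits_def)

text \<open>By right-continuity at time \<open>0\<close> no path leaves the ball arbitrarily early,
  so the exit events for \<open>h = 1 / (n + 1)\<close> decrease to the empty set.\<close>

lemma prob_exit_small:
  assumes r: "0 < r" and e: "0 < e"
  shows "\<exists>h>0. prob (hits 0 {z. r < norm z} 0 h) < e"
proof -
  let ?V = "{z :: 'a. r < norm z}"
  have V: "open ?V" by (intro open_Collect_less continuous_intros)
  let ?H = "\<lambda>n. hits 0 ?V 0 (1 / real (Suc n))"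
  have "(\<lambda>n. prob (?H n)) \<longlonglongrightarrow> prob (\<Inter>n. ?H n)"
  proof (rule finite_Lim_measure_decseq)
    show "range ?H \<subseteq> sets M" using hits_sets[OF V] by auto
    show "decseq ?H" unfolding decseq_def by (intro allI impI hits_mono) (auto intro!: divide_left_mono)
  qed
  moreover have "(\<Inter>n. ?H n) = {}"
  proof (rule ccontr)
    assume "(\<Inter>n. ?H n) \<noteq> {}"
    then obtain \<omega> where \<omega>: "\<And>n. \<omega> \<in> ?H n" by auto
    have "((\<lambda>s. X s \<omega>) \<longlongrightarrow> 0) (at_right 0)" using X_rc[of \<omega> 0] by (simp add: X_nonpos)
    from tendstoD[OF this r] obtain b where b: "b > 0" "\<And>y. 0 < y \<Longrightarrow> y < b \<Longrightarrow> norm (X y \<omega>) < r"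
      by (auto simp: eventually_at_right_field)
    obtain n where n: "1 / real (Suc n) < b" using b(1) by (metis nat_approx_posE)
    from \<omega>[of n] obtain u where u: "0 \<le> u" "u < 1 / real (Suc n)" "r < norm (X u \<omega>)"
      by (auto simp: hits_def)
    then have "u \<noteq> 0" using r by (auto simp: X_nonpos)
    then show False using b(2)[of u] u n by auto
  qed
  ultimately have "(\<lambda>n. prob (?H n)) \<longlonglongrightarrow> 0" by simp
  then have "\<forall>\<^sub>F n in sequentially. prob (?H n) < e" using e by (rule order_tendstoD)
  then obtain n where "prob (?H n) < e" by (auto simp: eventually_sequentially)
  then show ?thesis by (intro exI[of _ "1 / real (Suc n)"]) auto
qed

section \<open>The two conditions, the discount rate, and the implications between them\<close>

definition small_time_kato :: "('a \<Rightarrow> ennreal) \<Rightarrow> bool" where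
  "small_time_kato f \<longleftrightarrow> (\<forall>e>0. \<exists>t>0. \<forall>x. occ 0 {0..t} f x \<le> ennreal e)"

definition small_ball_kato :: "real \<Rightarrow> ('a \<Rightarrow> ennreal) \<Rightarrow> bool" where
  "small_ball_kato l f \<longleftrightarrow>
    (\<forall>e>0. \<exists>r>0. \<forall>x. occ l {0..} (\<lambda>y. indicator (ball x r) y * f y) x \<le> ennreal e)"

text \<open>(II) controls the potential of a ball only at its centre. From a start inside
  \<open>ball x r\<close> this ball lies within radius \<open>2 * r\<close> of the start; the
  maximum principle treats all other starts.\<close>

lemma occ_ball_le:
  assumes l: "0 \<le> l" and f[measurable]: "f \<in> borel_measurable borel"
    and C: "\<And>x. occ l {0..} (\<lambda>y. indicator (ball x (2 * r)) y * f y) x \<le> C"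
  shows "occ l {0..} (\<lambda>y. indicator (ball x r) y * f y) z \<le> C"
proof (rule maximum_principle[OF l])
  fix y assume "y \<in> ball x r"
  then have "ball x r \<subseteq> ball y (2 * r)" by (smt (verit) dist_commute dist_triangle mem_ball subsetI)
  then have "occ l {0..} (\<lambda>z. indicator (ball x r) z * f z) y
      \<le> occ l {0..} (\<lambda>z. indicator (ball y (2 * r)) z * f z) y"
    by (intro occ_mono mult_right_mono) (auto split: split_indicator)
  then show "occ l {0..} (\<lambda>z. indicator (ball x r) z * f z) y \<le> C" using C order_trans by blast
qed auto

text \<open>On \<open>{0..<1}\<close> the weights compare up to the factor \<open>exp l\<close>, and
  \<open>occ_le_of_initial\<close> rebuilds the whole potential at rate \<open>k\<close>;
  \<open>c\<close> collects both factors. The bound needed at every starting point comes from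
  \<open>occ_ball_le\<close>.\<close>

lemma small_ball_kato_rate:
  assumes f[measurable]: "f \<in> borel_measurable borel" and l: "0 < l" and k: "0 < k"
    and II: "small_ball_kato l f"
  shows "small_ball_kato k f"
  unfolding small_ball_kato_def
proof (intro allI impI)
  fix e :: real assume e: "0 < e"
  define c where "c = exp l * (1 / (1 - exp (- k * 1)))"
  have c: "0 < c" using k by (auto simp: c_def)
  from II e c obtain r where r: "0 < r"
    "\<And>x. occ l {0..} (\<lambda>y. indicator (ball x r) y * f y) x \<le> ennreal (e / c)"
    unfolding small_ball_kato_def by (meson divide_pos_pos)
  show "\<exists>r>0. \<forall>x. occ k {0..} (\<lambda>y. indicator (ball x r) y * f y) x \<le> ennreal e"
  proof (intro exI[of _ "r / 2"] conjI allI)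
    fix x :: 'a
    let ?g = "\<lambda>y. indicator (ball x (r / 2)) y * f y"
    have g: "occ l {0..} ?g z \<le> ennreal (e / c)" for z
      by (rule occ_ball_le) (simp_all add: r(2) less_imp_le[OF l])
    have "occ k {0..} ?g x \<le> ennreal (exp l) * ennreal (e / c) * ennreal (1 / (1 - exp (- k * 1)))"
    proof (rule occ_le_of_initial)
      fix z
      have "occ k {0..<1} ?g z \<le> ennreal (exp l) * occ l {0..<1} ?g z"
      proof (rule occ_mono_weight)
        fix u :: real assume "u \<in> {0..<1}"
        then have "0 \<le> k * u" "l * u \<le> l * 1" using l k by (auto intro!: mult_left_mono)
        then have "- k * u \<le> l + - l * u" by simp
        then show "exp (- k * u) \<le> exp l * exp (- l * u)" by (simp add: exp_add[symmetric])
      qed auto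
      also have "\<dots> \<le> ennreal (exp l) * occ l {0..} ?g z" by (intro mult_left_mono occ_mono) auto
      also have "\<dots> \<le> ennreal (exp l) * ennreal (e / c)" by (intro mult_left_mono g) auto
      finally show "occ k {0..<1} ?g z \<le> ennreal (exp l) * ennreal (e / c)" .
    qed (use k in auto)
    also have "\<dots> = ennreal (exp l * (e / c) * (1 / (1 - exp (- k * 1))))"
    proof -
      have "0 \<le> e / c" "0 \<le> 1 / (1 - exp (- k * 1))" using e c k by auto
      then show ?thesis by (simp only: ennreal_mult'')
    qed
    also have "exp l * (e / c) * (1 / (1 - exp (- k * 1))) = (e / c) * c" by (simp add: c_def)
    also have "\<dots> = e" using c by simp
    finally show "occ k {0..} ?g x \<le> ennreal e" .
  qed (use r in auto)
qed

text \<open>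
  For a large rate \<open>k\<close> the discounted probability of leaving a ball is at most \<open>1 / 2\<close>; the supremum \<open>S\<close> of
  the \<open>k\<close>-potential then satisfies \<open>S \<le> C + S / 2\<close>, with \<open>C\<close> coming from the ball. Truncation makes \<open>S\<close> finite.
\<close>

lemma small_ball_imp_small_time:
  assumes f[measurable]: "f \<in> borel_measurable borel" and l: "0 < l" and II: "small_ball_kato l f"
  shows "small_time_kato f"
  unfolding small_time_kato_def
proof (intro allI impI)
  fix e :: real assume e: "0 < e"
  \<comment> \<open>The potential at rate \<open>k\<close> will be at most \<open>2 * C\<close>, and
    removing the discount on \<open>{0..1 / k}\<close> costs a factor \<open>exp 1\<close>.\<close>
  define C where "C = e / (2 * exp 1)"
  have C: "0 < C" using e by (simp add: C_def)
  from II C obtain r where r: "0 < r"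
    "\<And>x. occ l {0..} (\<lambda>y. indicator (ball x r) y * f y) x \<le> ennreal C"
    unfolding small_ball_kato_def by blast
  obtain h where h: "0 < h" "prob (hits 0 {z. r / 2 < norm z} 0 h) < 1 / 4"
    using prob_exit_small[of "r / 2" "1 / 4"] r by auto
  \<comment> \<open>\<open>l \<le> k\<close> transfers the bound from (II) to rate \<open>k\<close>;
    the other term makes the discount after \<open>h\<close> at most \<open>1 / 4\<close>, which
    with an exit probability below \<open>1 / 4\<close> yields the factor
    \<open>1 / 2\<close>.\<close>
  define k where "k = max l (ln 4 / h)"
  have k: "0 < k" "l \<le> k" using l by (auto simp: k_def)
  have "ln 4 / h \<le> k" by (simp add: k_def)
  then have "ln 4 \<le> k * h" using h by (simp add: field_simps)
  then have "exp (- k * h) \<le> exp (- ln 4)" by simp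
  also have "\<dots> = (1 / 4 :: real)" by (simp add: exp_minus)
  finally have ekh: "exp (- k * h) \<le> 1 / 4" .
  have bound: "occ k {0..} f x \<le> ennreal (2 * C)" for x
  proof (rule occ_le_truncated[OF f])
    fix N :: nat
    define g where "g y = min (f y) (of_nat N)" for y
    have [measurable]: "g \<in> borel_measurable borel" unfolding g_def by measurable
    define S where "S = (SUP x. occ k {0..} g x)"
    have "g y \<le> ennreal (real N)" for y by (auto simp: g_def ennreal_of_nat_eq_real_of_nat)
    then have "occ k {0..} g x \<le> occ k {0..} (\<lambda>y. ennreal (real N)) x" for x by (intro occ_mono) auto
    then have "S \<le> ennreal (real N) * ennreal (1 / k)" using k unfolding S_def by (auto simp: occ_const intro: SUP_least)
    then have fin: "S < \<infinity>" by (rule order.strict_trans1) (auto simp: ennreal_mult_less_top)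
    have "occ k {0..} g x \<le> ennreal C + ennreal (1 / 2) * S" for x
    proof -
      \<comment> \<open>Open, as \<open>occ_le_hits\<close> requires, and overlapping
        \<open>ball x r\<close> so that the two sets still cover the space.\<close>
      define V where "V = {y. r / 2 < norm (y - x)}"
      have V: "open V" unfolding V_def by (intro open_Collect_less continuous_intros)
      then have [measurable]: "V \<in> sets borel" by simp
      have "occ k {0..} g x \<le> occ k {0..} (\<lambda>y. indicator (ball x r) y * g y + indicator V y * g y) x"
        using r by (intro occ_mono) (auto simp: V_def dist_norm norm_minus_commute split: split_indicator)
      also have "\<dots> = occ k {0..} (\<lambda>y. indicator (ball x r) y * g y) x + occ k {0..} (\<lambda>y. indicator V y * g y) x"
        by (intro occ_add) auto
      also have "\<dots> \<le> ennreal C + ennreal (1 / 2) * S"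
      proof (intro add_mono)
        have "occ k {0..} (\<lambda>y. indicator (ball x r) y * g y) x \<le> ennreal 1 * occ l {0..} (\<lambda>y. indicator (ball x r) y * g y) x"
          using k by (intro occ_mono_weight) (auto intro: mult_right_mono)
        also have "\<dots> \<le> occ l {0..} (\<lambda>y. indicator (ball x r) y * f y) x"
          by simp (intro occ_mono mult_left_mono, auto simp: g_def)
        also have "\<dots> \<le> ennreal C" by (rule r)
        finally show "occ k {0..} (\<lambda>y. indicator (ball x r) y * g y) x \<le> ennreal C" .
        let ?H = "hits x V 0 h"
        have "?H \<subseteq> hits 0 {z. r / 2 < norm z} 0 h" by (intro hits_shift) (auto simp: V_def)
        then have "prob ?H \<le> prob (hits 0 {z. r / 2 < norm z} 0 h)"
          by (intro finite_measure_mono hits_sets open_Collect_less continuous_intros) auto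
        then have "emeasure M ?H \<le> ennreal (1 / 4)" using h by (auto simp: emeasure_eq_measure intro!: ennreal_leI)
        moreover have "ennreal (exp (- k * h)) * emeasure M (space M - ?H) \<le> ennreal (1 / 4) * 1"
          using ekh by (intro mult_mono ennreal_leI emeasure_le_1) auto
        ultimately have "emeasure M ?H + ennreal (exp (- k * h)) * emeasure M (space M - ?H) \<le> ennreal (1 / 4) + ennreal (1 / 4) * 1"
          by (intro add_mono)
        also have "\<dots> = ennreal (1 / 2)" by (simp add: ennreal_plus[symmetric] del: ennreal_plus)
        finally have "S * (emeasure M ?H + ennreal (exp (- k * h)) * emeasure M (space M - ?H)) \<le> S * ennreal (1 / 2)"
          by (rule mult_left_mono) simp
        moreover have "occ k {0..} (\<lambda>y. indicator V y * g y) x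
            \<le> S * (emeasure M ?H + ennreal (exp (- k * h)) * emeasure M (space M - ?H))"
          using k V by (intro occ_le_hits) (auto simp: S_def intro: SUP_upper)
        ultimately show "occ k {0..} (\<lambda>y. indicator V y * g y) x \<le> ennreal (1 / 2) * S"
          by (simp add: mult.commute)
      qed
      finally show ?thesis .
    qed
    then have "S \<le> ennreal C + ennreal (1 / 2) * S" by (auto simp: S_def intro: SUP_least)
    from ennreal_le_contraction[OF this fin]
    have "S \<le> ennreal C * ennreal (1 / (1 - 1 / 2))" by auto
    also have "\<dots> = ennreal (C * (1 / (1 - 1 / 2)))" by (rule ennreal_mult''[symmetric]) simp
    also have "C * (1 / (1 - 1 / 2)) = 2 * C" by simp
    finally show "occ k {0..} (\<lambda>y. min (f y) (of_nat N)) x \<le> ennreal (2 * C)"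
      unfolding g_def[symmetric] by (rule order_trans[rotated]) (auto simp: S_def intro: SUP_upper)
  qed auto
  show "\<exists>t>0. \<forall>x. occ 0 {0..t} f x \<le> ennreal e"
  proof (intro exI[of _ "1 / k"] conjI allI)
    fix x
    have "occ 0 {0..1 / k} f x \<le> ennreal (exp 1) * occ k {0..1 / k} f x"
    proof (rule occ_mono_weight)
      fix u assume "u \<in> {0..1 / k}"
      then have "k * u \<le> 1" using k by (auto simp: field_simps)
      then show "exp (- 0 * u) \<le> exp 1 * exp (- k * u)" by (simp add: exp_add[symmetric])
    qed auto
    also have "\<dots> \<le> ennreal (exp 1) * occ k {0..} f x" by (intro mult_left_mono occ_mono) auto
    also have "\<dots> \<le> ennreal (exp 1) * ennreal (2 * C)" by (intro mult_left_mono bound) auto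
    also have "\<dots> = ennreal e" using C by (simp add: ennreal_mult[symmetric] C_def)
    finally show "occ 0 {0..1 / k} f x \<le> ennreal e" .
  qed (use k in auto)
qed

text \<open>
  Once the process has left a small ball for time \<open>t\<close>, it comes back with discounted probability at most
  some \<open>K < 1\<close>, so the supremum \<open>S\<close> of the potential satisfies \<open>S \<le> \<delta> + K S\<close>.
\<close>

lemma small_time_imp_small_ball:
  assumes f[measurable]: "f \<in> borel_measurable borel" and I: "small_time_kato f"
    and h: "0 < h" and p: "p < 1"
    and escape: "\<And>t. 0 < t \<Longrightarrow> \<exists>r>0. prob (hits 0 (ball 0 r) t h) \<le> p"
  shows "small_ball_kato 1 f"
  unfolding small_ball_kato_def
proof (intro allI impI)
  fix e :: real assume e: "0 < e"
  have init: "occ 1 {0..<t} g x \<le> occ 0 {0..t} g x" if [measurable]: "g \<in> borel_measurable borel" for t g x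
  proof -
    have "occ 1 {0..<t} g x \<le> ennreal 1 * occ 0 {0..<t} g x" by (intro occ_mono_weight) auto
    also have "\<dots> \<le> occ 0 {0..t} g x" by simp (intro occ_mono, auto)
    finally show ?thesis .
  qed
  \<comment> \<open>Only a crude bound: it makes the supremum \<open>S\<close> below finite.\<close>
  obtain t1 where t1: "0 < t1" "\<And>x. occ 0 {0..t1} f x \<le> ennreal 1"
    using I unfolding small_time_kato_def by (meson zero_less_one)
  define D where "D = ennreal 1 * ennreal (1 / (1 - exp (- 1 * t1)))"
  have D: "occ 1 {0..} f x \<le> D" for x
    unfolding D_def by (rule occ_le_of_initial) (use t1 order_trans[OF init t1(2)] in auto)
  have D_fin: "D < \<infinity>" by (auto simp: D_def ennreal_mult_less_top)
  define p' where "p' = max p 0"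
  have p': "0 \<le> p'" "p' < 1" "p \<le> p'" using p by (auto simp: p'_def)
  \<comment> \<open>The largest value of \<open>P + exp (- h) * (1 - P)\<close>, the factor from
    \<open>occ_le_hits\<close>, over hitting probabilities \<open>P \<le> p'\<close>. It depends
    only on \<open>h\<close> and \<open>p\<close>.\<close>
  define K where "K = p' + exp (- 1 * h) * (1 - p')"
  have eh: "exp (- 1 * h) < 1" "0 < exp (- 1 * h)" using h by auto
  have "exp (- 1 * h) * (1 - p') < 1 * (1 - p')" using eh p' by (intro mult_strict_right_mono) auto
  then have "p' + exp (- 1 * h) * (1 - p') < 1" by (simp only: less_diff_eq add.commute mult_1_left)
  then have "K < 1" unfolding K_def .
  moreover have "0 \<le> K" using p' by (simp add: K_def)
  ultimately have K: "0 \<le> K" "K < 1" by auto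
  \<comment> \<open>The factor \<open>1 - K\<close> is what the contraction divides by at the end.
    The radius \<open>r\<close> is chosen last and may depend on \<open>t\<close>.\<close>
  obtain t where t: "0 < t" "\<And>x. occ 0 {0..t} f x \<le> ennreal (e * (1 - K))"
    using I K e unfolding small_time_kato_def by (metis diff_gt_0_iff_gt mult_pos_pos)
  obtain r where r: "0 < r" "prob (hits 0 (ball 0 r) t h) \<le> p" using escape[OF t(1)] by auto
  show "\<exists>r>0. \<forall>x. occ 1 {0..} (\<lambda>y. indicator (ball x r) y * f y) x \<le> ennreal e"
  proof (intro exI[of _ "r / 2"] conjI allI)
    fix x :: 'a
    let ?V = "ball x (r / 2)"
    define g where "g y = indicator ?V y * f y" for y
    have [measurable]: "g \<in> borel_measurable borel" unfolding g_def by measurable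
    have gf: "g y \<le> f y" for y by (auto simp: g_def split: split_indicator)
    have Vg: "(\<lambda>y. indicator ?V y * g y) = g" by (auto simp: g_def fun_eq_iff split: split_indicator)
    define S where "S = (SUP y. occ 1 {0..} g y)"
    have "S \<le> D" unfolding S_def by (intro SUP_least order_trans[OF occ_mono D] gf) auto
    then have fin: "S < \<infinity>" using D_fin by auto
    have near: "occ 1 {0..} g y \<le> ennreal (e * (1 - K)) + ennreal K * S" if y: "y \<in> ?V" for y
    proof -
      have "occ 1 {0..} g y = occ 1 {0..<t} g y + occ 1 {t..} g y" using t by (intro occ_split) auto
      also have "\<dots> \<le> ennreal (e * (1 - K)) + ennreal K * S"
      proof (intro add_mono)
        have "occ 1 {0..<t} g y \<le> occ 0 {0..t} g y" by (rule init) simp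
        also have "\<dots> \<le> occ 0 {0..t} f y" by (intro occ_mono gf) auto
        also have "\<dots> \<le> ennreal (e * (1 - K))" by (rule t)
        finally show "occ 1 {0..<t} g y \<le> ennreal (e * (1 - K))" .
        let ?H = "hits y ?V t h"
        have [measurable]: "?H \<in> sets M" by (intro hits_sets) auto
        \<comment> \<open>Two points of a ball of radius \<open>r / 2\<close> are less than
          \<open>r\<close> apart, so a return to \<open>?V\<close> is a return to within
          \<open>r\<close> of the start \<open>y\<close>.\<close>
        have "?H \<subseteq> hits 0 (ball 0 r) t h"
        proof (rule hits_shift)
          fix u assume "y + u \<in> ?V"
          then have "dist x (y + u) < r / 2" "dist x y < r / 2" using y by auto
          then have "dist y (y + u) < r" using dist_triangle_less_add[of y x "r / 2" "y + u" "r / 2"]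
            by (auto simp: dist_commute)
          then show "u \<in> ball 0 r" by (simp add: dist_norm)
        qed
        then have "prob ?H \<le> prob (hits 0 (ball 0 r) t h)"
          by (intro finite_measure_mono hits_sets) auto
        then have ph: "prob ?H \<le> p'" using r p' by auto
        have "emeasure M ?H + ennreal (exp (- 1 * h)) * emeasure M (space M - ?H)
            = ennreal (prob ?H + exp (- 1 * h) * (1 - prob ?H))"
          using measure_nonneg[of M ?H] prob_le_1[of ?H]
          by (simp add: emeasure_eq_measure prob_compl ennreal_mult[symmetric] ennreal_plus[symmetric] del: ennreal_plus)
        also have "\<dots> \<le> ennreal K"
        proof (rule ennreal_leI)
          have "(p' - prob ?H) * exp (- 1 * h) \<le> (p' - prob ?H) * 1"
            using ph eh by (intro mult_left_mono) auto
          then show "prob ?H + exp (- 1 * h) * (1 - prob ?H) \<le> K"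
            unfolding K_def by (simp add: algebra_simps)
        qed
        finally have "S * (emeasure M ?H + ennreal (exp (- 1 * h)) * emeasure M (space M - ?H)) \<le> S * ennreal K"
          by (rule mult_left_mono) simp
        moreover have "occ 1 {t..} (\<lambda>y. indicator ?V y * g y) y
            \<le> S * (emeasure M ?H + ennreal (exp (- 1 * h)) * emeasure M (space M - ?H))"
          using t by (intro occ_le_hits) (auto simp: S_def intro: SUP_upper)
        ultimately show "occ 1 {t..} g y \<le> ennreal K * S"
          unfolding Vg mult.commute[of "ennreal K"] by (rule order_trans[rotated])
      qed
      finally show ?thesis .
    qed
    have "occ 1 {0..} (\<lambda>y. indicator ?V y * g y) y \<le> ennreal (e * (1 - K)) + ennreal K * S" for y
      by (rule maximum_principle) (use near in \<open>auto simp: Vg\<close>)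
    then have "S \<le> ennreal (e * (1 - K)) + ennreal K * S" by (auto simp: Vg S_def intro: SUP_least)
    from ennreal_le_contraction[OF this fin K] have "S \<le> ennreal (e * (1 - K)) * ennreal (1 / (1 - K))" .
    also have "\<dots> = ennreal e" using K e by (simp add: ennreal_mult[symmetric])
    finally show "occ 1 {0..} (\<lambda>y. indicator ?V y * f y) x \<le> ennreal e"
      unfolding g_def[symmetric] by (rule order_trans[rotated]) (auto simp: S_def intro: SUP_upper)
  qed (use r in auto)
qed

text \<open>If the path from \<open>y\<close> is in the open set \<open>G\<close> at time
  \<open>u\<close>, so are its translates from nearby points; Fatou along a sequence
  \<open>z n\<close> tending to \<open>y\<close> gives lower semicontinuity.\<close>

lemma occ_open_lsc:
  assumes G: "open G" and less: "c < occ l {0..} (indicator G) y"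
  shows "\<exists>r>0. \<forall>z\<in>ball y r. c \<le> occ l {0..} (indicator G) z"
proof (rule ccontr)
  have [measurable]: "G \<in> sets borel" using G by simp
  assume "\<not> ?thesis"
  then have no: "\<not> (\<forall>z\<in>ball y r. c \<le> occ l {0..} (indicator G) z)" if "0 < r" for r
    using that by blast
  have "\<exists>z. z \<in> ball y (1 / real (Suc n)) \<and> occ l {0..} (indicator G) z < c" for n
    using no[of "1 / real (Suc n)"] by (auto simp only: not_le Ball_def) auto
  then obtain z where z: "\<And>n. z n \<in> ball y (1 / real (Suc n))" "\<And>n. occ l {0..} (indicator G) (z n) < c"
    by metis
  have z_lim: "z \<longlonglongrightarrow> y"
  proof (rule metric_tendsto_imp_tendsto)
    show "(\<lambda>n. 1 / real (Suc n)) \<longlonglongrightarrow> 0" by (rule LIMSEQ_Suc[OF lim_1_over_n])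
    show "\<forall>\<^sub>F n in sequentially. dist (z n) y \<le> dist (1 / real (Suc n)) 0"
      using z(1) by (auto intro!: always_eventually simp: dist_commute less_imp_le)
  qed
  let ?w = "\<lambda>u. ennreal (exp (- l * u)) * indicator {0..} u"
  have "occ l {0..} (indicator G) y \<le> (\<integral>\<^sup>+\<omega>. \<integral>\<^sup>+u. liminf (\<lambda>n. ?w u * indicator G (z n + X u \<omega>)) \<partial>lborel \<partial>M)"
    unfolding occ_def
  proof (intro nn_integral_mono)
    fix \<omega> u
    show "?w u * indicator G (y + X u \<omega>) \<le> liminf (\<lambda>n. ?w u * indicator G (z n + X u \<omega>))"
    proof (cases "y + X u \<omega> \<in> G")
      case True
      have "(\<lambda>n. z n + X u \<omega>) \<longlonglongrightarrow> y + X u \<omega>" by (intro tendsto_intros z_lim)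
      from topological_tendstoD[OF this G True]
      have "\<forall>\<^sub>F n in sequentially. ?w u * indicator G (y + X u \<omega>) \<le> ?w u * indicator G (z n + X u \<omega>)"
        by (rule eventually_mono) (simp add: True)
      then show ?thesis by (rule Liminf_bounded)
    qed simp
  qed
  also have "\<dots> \<le> (\<integral>\<^sup>+\<omega>. liminf (\<lambda>n. \<integral>\<^sup>+u. ?w u * indicator G (z n + X u \<omega>) \<partial>lborel) \<partial>M)"
    by (intro nn_integral_mono nn_integral_liminf) measurable
  also have "\<dots> \<le> liminf (\<lambda>n. occ l {0..} (indicator G) (z n))"
    unfolding occ_def by (intro nn_integral_liminf) measurable
  also have "\<dots> \<le> c" using z(2) by (intro Liminf_le always_eventually) (auto intro: less_imp_le)
  finally show False using less by simp
qed

text \<open>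
  After time \<open>t\<close> the process comes back arbitrarily close to its starting point almost at once, and
  from there accumulates nearly the whole potential again; so the part accumulated before \<open>t\<close> is a small fraction
  of the total. Lower semicontinuity replaces exact returns by returns to small balls.
\<close>

lemma occ_open_initial_le:
  assumes "0 < \<eta>" and ret: "\<And>h p. 0 < h \<Longrightarrow> p < 1 \<Longrightarrow> \<exists>t>0. \<forall>r>0. p \<le> prob (hits 0 (ball 0 r) t h)"
  shows "\<exists>t>0. \<forall>G y. open G \<longrightarrow> occ 1 {0..<t} (indicator G) y \<le> ennreal \<eta> * occ 1 {0..} (indicator G) y"
proof -
  \<comment> \<open>\<open>a\<close> serves both as the return probability and as the discount
    \<open>exp (- h)\<close> for \<open>h = - ln a\<close>; then
    \<open>a * a \<ge> 2 * a - 1 \<ge> 1 - \<eta>\<close>. The \<open>1 / 2\<close> keeps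
    \<open>a\<close> positive.\<close>
  define a where "a = max (1 - \<eta> / 2) (1 / 2)"
  have a: "0 < a" "a < 1" "1 - \<eta> / 2 \<le> a" using assms by (auto simp: a_def)
  have "0 < - ln a" using a by simp
  \<comment> \<open>\<open>t\<close> is fixed before \<open>G\<close> and \<open>y\<close>, so one
    time will serve all bumps of a series.\<close>
  then obtain t where t: "0 < t" "\<And>r. 0 < r \<Longrightarrow> a \<le> prob (hits 0 (ball 0 r) t (- ln a))"
    using ret a by blast
  show ?thesis
  proof (intro exI[of _ t] conjI allI impI)
    fix G :: "'a set" and y assume G: "open G"
    then have [measurable]: "G \<in> sets borel" by simp
    let ?p = "occ 1 {0..} (indicator G) y"
    have p_fin: "?p < \<infinity>" by (rule occ_bounded[where c=1]) (auto split: split_indicator)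
    \<comment> \<open>Semicontinuity yields a whole ball only for levels \<open>c\<close> strictly
      below the potential at \<open>y\<close>; \<open>dense_le\<close> then recovers the potential
      itself.\<close>
    have "c * ennreal (a * a) \<le> occ 1 {t..} (indicator G) y" if c: "c < ?p" for c
    proof -
      obtain r where r: "0 < r" "\<And>z. z \<in> ball y r \<Longrightarrow> c \<le> occ 1 {0..} (indicator G) z"
        using occ_open_lsc[OF G c] by auto
      have "hits 0 (ball 0 r) t (- ln a) \<subseteq> hits y (ball y r) t (- ln a)"
        by (force simp: hits_def dist_norm)
      then have "prob (hits 0 (ball 0 r) t (- ln a)) \<le> prob (hits y (ball y r) t (- ln a))"
        by (intro finite_measure_mono hits_sets) auto
      with t(2)[OF r(1)] have "a \<le> prob (hits y (ball y r) t (- ln a))" by simp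
      then have "ennreal (a * a) \<le> ennreal (exp (- 1 * (- ln a))) * emeasure M (hits y (ball y r) t (- ln a))"
        using a by (simp add: emeasure_eq_measure ennreal_mult[symmetric] mult_left_mono)
      then have "c * ennreal (a * a) \<le> c * (ennreal (exp (- 1 * (- ln a))) * emeasure M (hits y (ball y r) t (- ln a)))"
        by (rule mult_left_mono) simp
      also have "\<dots> \<le> occ 1 {t..} (indicator G) y"
        using t r(2) by (intro occ_ge_hits) auto
      finally show ?thesis .
    qed
    then have late: "?p * ennreal (a * a) \<le> occ 1 {t..} (indicator G) y"
    proof -
      assume *: "\<And>c. c < ?p \<Longrightarrow> c * ennreal (a * a) \<le> occ 1 {t..} (indicator G) y"
      have inv: "c * ennreal (a * a) * ennreal (1 / (a * a)) = c" for c
        using a by (simp add: mult.assoc ennreal_mult''[symmetric])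
      have "c \<le> occ 1 {t..} (indicator G) y * ennreal (1 / (a * a))" if "c < ?p" for c
        using mult_right_mono[OF *[OF that], of "ennreal (1 / (a * a))"] unfolding inv by simp
      then have "?p \<le> occ 1 {t..} (indicator G) y * ennreal (1 / (a * a))" by (rule dense_le)
      from mult_right_mono[OF this, of "ennreal (a * a)"] show ?thesis
        by (metis inv mult.assoc mult.commute zero_le)
    qed
    have split: "?p = occ 1 {0..<t} (indicator G) y + occ 1 {t..} (indicator G) y"
      using t by (intro occ_split) auto
    have fin2: "occ 1 {0..<t} (indicator G) y < \<infinity>" "occ 1 {t..} (indicator G) y < \<infinity>"
      using p_fin unfolding split by auto
    obtain p b c where pbc: "?p = ennreal p" "occ 1 {0..<t} (indicator G) y = ennreal b" "occ 1 {t..} (indicator G) y = ennreal c"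
      "0 \<le> p" "0 \<le> b" "0 \<le> c"
      using p_fin fin2 by (metis ennreal_cases infinity_ennreal_def less_irrefl)
    have "p = b + c" using split pbc by (simp add: ennreal_plus[symmetric] del: ennreal_plus)
    moreover have "p * (a * a) \<le> c" using late pbc a by (simp add: ennreal_mult[symmetric])
    moreover have "p * (1 - \<eta>) \<le> p * (a * a)"
    proof (rule mult_left_mono)
      have "0 \<le> (1 - a) * (1 - a)" using a by simp
      then show "1 - \<eta> \<le> a * a" using a(3) by (simp add: algebra_simps)
    qed (use pbc in auto)
    ultimately have "b \<le> \<eta> * p" by (simp add: algebra_simps)
    then show "occ 1 {0..<t} (indicator G) y \<le> ennreal \<eta> * ?p"
      using pbc assms by (simp add: ennreal_mult[symmetric])
  qed (use t in auto)
qed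

section \<open>A separating function in the regular case\<close>

text \<open>Every path stays in the ball during an initial interval of positive length, by
  right-continuity at time \<open>0\<close>.\<close>

lemma occ_ball_pos:
  assumes r: "0 < r"
  shows "0 < occ l {0..} (indicator (ball 0 r)) 0"
proof -
  let ?J = "\<lambda>\<omega>. \<integral>\<^sup>+u. ennreal (exp (- l * u)) * indicator {0..} u * indicator (ball 0 r) (0 + X u \<omega>) \<partial>lborel"
  have pos: "0 < ?J \<omega>" for \<omega>
  proof -
    have "((\<lambda>s. X s \<omega>) \<longlongrightarrow> 0) (at_right 0)" using X_rc[of \<omega> 0] by (simp add: X_nonpos)
    from tendstoD[OF this r] obtain b where b: "b > 0" "\<And>y. 0 < y \<Longrightarrow> y < b \<Longrightarrow> norm (X y \<omega>) < r"
      by (auto simp: eventually_at_right_field)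
    have "\<not> (AE u in lborel. ennreal (exp (- l * u)) * indicator {0..} u * indicator (ball 0 r) (0 + X u \<omega>) = 0)"
    proof
      assume "AE u in lborel. ennreal (exp (- l * u)) * indicator {0..} u * indicator (ball 0 r) (0 + X u \<omega>) = 0"
      then have "AE u in lborel. u \<notin> {0<..<b}"
      proof (rule eventually_mono)
        fix u assume *: "ennreal (exp (- l * u)) * indicator {0..} u * indicator (ball 0 r) (0 + X u \<omega>) = 0"
        show "u \<notin> {0<..<b}"
        proof
          assume "u \<in> {0<..<b}"
          with b(2)[of u] * show False by (auto simp: ennreal_eq_0_iff)
        qed
      qed
      then have "{0<..<b} \<in> null_sets lborel" by (subst (asm) AE_iff_null_sets[symmetric]) auto
      then show False using b by (simp add: null_sets_def)
    qed
    then have "?J \<omega> \<noteq> 0" by (subst nn_integral_0_iff_AE) auto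
    then show ?thesis by (simp add: zero_less_iff_neq_zero)
  qed
  have "occ l {0..} (indicator (ball 0 r)) 0 \<noteq> 0"
  proof
    assume "occ l {0..} (indicator (ball 0 r)) 0 = 0"
    then have "AE \<omega> in M. ?J \<omega> = 0"
      unfolding occ_def by (subst (asm) nn_integral_0_iff_AE) auto
    then have "AE \<omega> in M. False" by (rule eventually_mono) (use pos in \<open>auto simp: less_le\<close>)
    then show False by simp
  qed
  then show ?thesis by (simp add: zero_less_iff_neq_zero)
qed

text \<open>At rate \<open>1\<close> the potential from \<open>0\<close> is a measure of total mass
  \<open>1\<close>, so its mass outside large balls tends to \<open>0\<close>.\<close>

lemma occ_tail_small:
  assumes e: "0 < e"
  shows "\<exists>R\<ge>0. occ 1 {0..} (indicator {z. R \<le> norm z}) 0 \<le> ennreal e"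
proof -
  let ?f = "\<lambda>n::nat. indicator {z :: 'a. norm z < real n} :: 'a \<Rightarrow> ennreal"
  let ?g = "\<lambda>n::nat. indicator {z :: 'a. real n \<le> norm z} :: 'a \<Rightarrow> ennreal"
  have [measurable]: "{z :: 'a. norm z < real n} \<in> sets borel" "{z :: 'a. real n \<le> norm z} \<in> sets borel" for n
    by (intro borel_open open_Collect_less borel_closed closed_Collect_le continuous_intros)+
  have one: "(SUP n. ?f n y) = 1" for y
  proof -
    obtain n where "norm y < real n" using reals_Archimedean2 by blast
    then have "1 \<le> (SUP n. ?f n y)" by (intro SUP_upper2[of n]) auto
    moreover have "(SUP n. ?f n y) \<le> 1" by (intro SUP_least) (auto split: split_indicator)
    ultimately show ?thesis by (rule antisym[rotated])
  qed
  have "occ 1 {0..} (\<lambda>y. SUP n. ?f n y) 0 = (SUP n. occ 1 {0..} (?f n) 0)"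
    by (rule occ_SUP) (auto simp: incseq_def le_fun_def split: split_indicator)
  then have "(SUP n. occ 1 {0..} (?f n) 0) = 1" by (simp add: one occ_const)
  moreover have "ennreal (1 - e) < 1" using e by (simp add: ennreal_less_one_iff)
  ultimately have "ennreal (1 - e) < (SUP n. occ 1 {0..} (?f n) 0)" by simp
  then obtain n where n: "ennreal (1 - e) < occ 1 {0..} (?f n) 0"
    unfolding less_SUP_iff by blast
  have "occ 1 {0..} (\<lambda>y. ?f n y + ?g n y) 0 = occ 1 {0..} (?f n) 0 + occ 1 {0..} (?g n) 0"
    by (rule occ_add) auto
  moreover have "(\<lambda>y. ?f n y + ?g n y) = (\<lambda>y. 1)" by (auto split: split_indicator)
  ultimately have sum: "occ 1 {0..} (?f n) 0 + occ 1 {0..} (?g n) 0 = 1" by (simp add: occ_const)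
  have "occ 1 {0..} (?f n) 0 < \<infinity>" "occ 1 {0..} (?g n) 0 < \<infinity>"
    by (rule occ_bounded[where c=1]; simp split: split_indicator)+
  then obtain b c where bc: "occ 1 {0..} (?f n) 0 = ennreal b" "occ 1 {0..} (?g n) 0 = ennreal c" "0 \<le> b" "0 \<le> c"
    by (metis ennreal_cases infinity_ennreal_def less_irrefl)
  have "b + c = 1" using sum bc by (simp add: ennreal_plus[symmetric] del: ennreal_plus)
  moreover have "1 - e < b"
  proof (rule ccontr)
    assume "\<not> 1 - e < b"
    then have "ennreal b \<le> ennreal (1 - e)" by (intro ennreal_leI) simp
    then show False using n bc by simp
  qed
  ultimately have "c \<le> e" by simp
  then show ?thesis using bc by (intro exI[of _ "real n"]) (auto intro: ennreal_leI)
qed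

text \<open>
  The function is a sum of bumps on shrinking balls, each normalised to have potential of supremum one,
  whose centres are so far apart that the potential of the sum stays bounded.
\<close>

lemma exists_small_time_not_small_ball:
  assumes ret: "\<And>h p. 0 < h \<Longrightarrow> p < 1 \<Longrightarrow> \<exists>t>0. \<forall>r>0. p \<le> prob (hits 0 (ball 0 r) t h)"
  shows "\<exists>q :: 'a \<Rightarrow> real. q \<in> borel_measurable borel \<and>
    small_time_kato (\<lambda>y. ennreal \<bar>q y\<bar>) \<and> \<not> small_ball_kato 1 (\<lambda>y. ennreal \<bar>q y\<bar>)"
proof -
  define r where "r k = 1 / real (Suc k)" for k
  have r: "0 < r k" "r k \<le> 1" for k by (auto simp: r_def)
  define cc where "cc k = (SUP y. occ 1 {0..} (indicator (ball (0::'a) (r k))) y)" for k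
  have cc_upper: "occ 1 {0..} (indicator (ball (0::'a) (r k))) y \<le> cc k" for k y
    unfolding cc_def by (rule SUP_upper) simp
  have cc_pos: "0 < cc k" for k
    using occ_ball_pos[OF r(1)] cc_upper by (rule order.strict_trans2)
  have "cc k \<le> 1" for k
    unfolding cc_def
  proof (rule SUP_least)
    fix y :: 'a
    have "occ 1 {0..} (indicator (ball (0::'a) (r k))) y \<le> occ 1 {0..} (\<lambda>_. 1) y"
      by (intro occ_mono) (auto split: split_indicator)
    then show "occ 1 {0..} (indicator (ball (0::'a) (r k))) y \<le> 1" by (simp add: occ_const)
  qed
  then have "cc k = ennreal (enn2real (cc k))" for k
    by (metis ennreal_enn2real ennreal_one_less_top order.strict_trans1)
  then obtain c where c: "\<And>k. cc k = ennreal (c k)" by (rule that)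
  have c_pos: "0 < c k" for k using cc_pos[of k] by (simp add: c)
  define a where "a k = 1 / c k" for k
  have a_pos: "0 < a k" and ac: "ennreal (a k) * cc k = 1" for k
    using c_pos[of k] by (auto simp: a_def c ennreal_mult[symmetric])
  \<comment> \<open>The factor \<open>c k\<close> cancels against \<open>a k\<close>, so bump
    \<open>k\<close> contributes at most \<open>(1 / 2) ^ k\<close> to starts for which reaching it
    takes a displacement of at least \<open>R k\<close>.\<close>
  have "\<exists>R\<ge>0. occ 1 {0..} (indicator {z. R \<le> norm z}) 0 \<le> ennreal (c k * (1 / 2) ^ k)" for k
    using c_pos[of k] by (intro occ_tail_small) auto
  then obtain R where R: "\<And>k. 0 \<le> R k"
    "\<And>k. occ 1 {0..} (indicator {z. R k \<le> norm z}) 0 \<le> ennreal (c k * (1 / 2) ^ k)" by metis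
  \<comment> \<open>Placed at \<open>p k\<close> on a line, the balls of radius
    \<open>R k + 1\<close> are adjacent to each other; the extra \<open>1\<close> absorbs the bump
    radius \<open>r k \<le> 1\<close>.\<close>
  define p where "p k = (\<Sum>i<Suc k. R i + 1) + (\<Sum>i<k. R i + 1)" for k
  have gap: "R j + 1 + (R k + 1) \<le> p k - p j" if "j < k" for j k
  proof -
    have "(\<Sum>i<Suc j. R i + 1) \<le> (\<Sum>i<k. R i + 1)"
      using that R by (intro sum_mono2) (auto intro: add_nonneg_nonneg)
    then show ?thesis by (simp add: p_def)
  qed
  obtain b :: 'a where b: "norm b = 1" using nonempty_Basis norm_Basis by blast
  define x where "x k = p k *\<^sub>R b" for k
  have "dist (x k) (x j) = \<bar>p k - p j\<bar>" for k j
    unfolding x_def dist_norm scaleR_diff_left[symmetric] using b by simp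
  then have sep: "R j + 1 + (R k + 1) \<le> dist (x k) (x j)" if "j \<noteq> k" for j k
    using gap[of j k] gap[of k j] that by (cases j k rule: linorder_cases) auto
  define near where "near y = {k. dist y (x k) < R k + 1}" for y
  have near_unique: "\<exists>k. near y \<subseteq> {k}" for y
  proof (cases "near y = {}")
    case False
    then obtain k where k: "k \<in> near y" by auto
    have "j = k" if j: "j \<in> near y" for j
    proof (rule ccontr)
      assume "j \<noteq> k"
      from sep[OF this] j k show False
        using dist_triangle3[of "x k" "x j" y] by (auto simp: near_def)
    qed
    then show ?thesis by auto
  qed auto
  define B where "B k = ball (x k) (r k)" for k
  have [measurable]: "B k \<in> sets borel" for k by (simp add: B_def)
  have B_near: "k \<in> near y" if "y \<in> B k" for y k
    using that r(2)[of k] R(1)[of k] by (auto simp: near_def B_def dist_commute)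
  define F where "F y = (\<Sum>k. ennreal (a k) * indicator (B k) y)" for y
  have [measurable]: "F \<in> borel_measurable borel" unfolding F_def by measurable
  have F_fin: "F y < \<infinity>" for y
  proof -
    obtain k where k: "near y \<subseteq> {k}" using near_unique by blast
    have "F y = ennreal (a k) * indicator (B k) y"
      unfolding F_def by (rule suminf_subsingleton) (use B_near k in \<open>force split: split_indicator_asm\<close>)
    then show ?thesis by (auto split: split_indicator)
  qed
  define q where "q y = enn2real (F y)" for y
  have q: "ennreal \<bar>q y\<bar> = F y" for y
    using F_fin by (simp add: q_def)
  have B_shift: "occ 1 {0..} (indicator (B k)) (x k + z) = occ 1 {0..} (indicator (ball 0 (r k))) z" for k z
  proof -
    have "occ 1 {0..} (indicator (B k)) (z + x k) = occ 1 {0..} (\<lambda>y. indicator (B k) (y + x k)) z"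
      by (rule occ_shift[symmetric])
    also have "(\<lambda>y. indicator (B k) (y + x k)) = (indicator (ball 0 (r k)) :: 'a \<Rightarrow> ennreal)"
      by (auto simp: fun_eq_iff B_def dist_norm split: split_indicator)
    finally show ?thesis by (simp add: add.commute)
  qed
  have occ_F: "occ 1 I F y = (\<Sum>k. ennreal (a k) * occ 1 I (indicator (B k)) y)" if [measurable]: "I \<in> sets borel" for I y
    unfolding F_def by (subst occ_suminf) (auto simp: occ_cmult)
  \<comment> \<open>\<open>3\<close> is \<open>1\<close> for the at most one bump near
    \<open>y\<close> plus \<open>2\<close> for the geometric series of distant
    contributions.\<close>
  have F_bound: "occ 1 {0..} F y \<le> ennreal 3" for y
  proof -
    have "ennreal (a k) * occ 1 {0..} (indicator (B k)) y \<le> indicator (near y) k + ennreal ((1 / 2) ^ k)" for k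
    proof (cases "k \<in> near y")
      case True
      have "ennreal (a k) * occ 1 {0..} (indicator (B k)) y \<le> ennreal (a k) * cc k"
        using B_shift[of k "y - x k"] cc_upper[of k "y - x k"] by (intro mult_left_mono) auto
      then show ?thesis using True ac by (simp add: add_increasing2)
    next
      case False
      have "occ 1 {0..} (indicator (B k)) y = occ 1 {0..} (\<lambda>z. indicator (B k) (z + y)) 0"
        by (simp add: occ_shift)
      also have "\<dots> \<le> occ 1 {0..} (indicator {z. R k \<le> norm z}) 0"
      proof (intro occ_mono indicator_leI)
        fix z assume "z + y \<in> B k"
        then have "dist (x k) (z + y) < 1" using r(2)[of k] by (auto simp: B_def)
        moreover have "R k + 1 \<le> dist y (x k)" using False by (auto simp: near_def)
        moreover have "dist y (x k) \<le> dist (z + y) y + dist (x k) (z + y)"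
          using dist_triangle2[of y "x k" "z + y"] by (simp add: dist_commute add.commute)
        moreover have "dist (z + y) y = norm z" by (simp add: dist_norm)
        ultimately show "z \<in> {z. R k \<le> norm z}" by simp
      qed auto
      also have "\<dots> \<le> ennreal (c k * (1 / 2) ^ k)" by (rule R)
      finally have "ennreal (a k) * occ 1 {0..} (indicator (B k)) y \<le> ennreal (a k) * ennreal (c k * (1 / 2) ^ k)"
        by (rule mult_left_mono) simp
      also have "\<dots> = ennreal ((1 / 2) ^ k)"
        using c_pos[of k] by (simp add: a_def ennreal_mult[symmetric])
      finally show ?thesis using False by simp
    qed
    then have "occ 1 {0..} F y \<le> (\<Sum>k. indicator (near y) k + ennreal ((1 / 2) ^ k))"
      by (subst occ_F) (auto intro!: suminf_le)
    also have "\<dots> = (\<Sum>k. indicator (near y) k) + (\<Sum>k. ennreal ((1 / 2) ^ k))"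
      by (rule suminf_add[symmetric]) auto
    also have "\<dots> \<le> 1 + ennreal 2"
    proof (rule add_mono)
      obtain k where k: "near y \<subseteq> {k}" using near_unique by blast
      have "(\<Sum>k. indicator (near y) k) = (indicator (near y) k :: ennreal)"
        by (rule suminf_subsingleton) (use k in \<open>force split: split_indicator_asm\<close>)
      then show "(\<Sum>k. indicator (near y) k) \<le> (1 :: ennreal)" by (auto split: split_indicator)
      have "(\<Sum>k. ennreal ((1 / 2) ^ k)) = ennreal (\<Sum>k. (1 / 2) ^ k)"
        by (rule suminf_ennreal2) (auto intro: summable_geometric)
      then show "(\<Sum>k. ennreal ((1 / 2) ^ k)) \<le> ennreal 2" by (simp add: suminf_geometric)
    qed
    also have "1 + ennreal 2 = ennreal (1 + 2)" by (subst ennreal_plus) auto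
    also have "1 + 2 = (3 :: real)" by simp
    finally show ?thesis .
  qed
  have "small_time_kato F"
    unfolding small_time_kato_def
  proof (intro allI impI)
    fix e :: real assume e: "0 < e"
    \<comment> \<open>\<open>3\<close> bounds the potential of \<open>F\<close>, and
      \<open>exp 1\<close> is the price of dropping the discount up to
      \<open>t' \<le> 1\<close>.\<close>
    define \<eta> where "\<eta> = e / (3 * exp 1)"
    have \<eta>: "0 < \<eta>" using e by (simp add: \<eta>_def)
    obtain t where t: "0 < t"
      "\<And>G y. open G \<Longrightarrow> occ 1 {0..<t} (indicator G) y \<le> ennreal \<eta> * occ 1 {0..} (indicator G) y"
      using occ_open_initial_le[OF \<eta> ret] by blast
    define t' where "t' = min (t / 2) 1"
    show "\<exists>t>0. \<forall>x. occ 0 {0..t} F x \<le> ennreal e"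
    proof (intro exI[of _ t'] conjI allI)
      fix y
      have "occ 0 {0..t'} F y \<le> ennreal (exp 1) * occ 1 {0..t'} F y"
        by (rule occ_mono_weight) (auto simp: t'_def exp_add[symmetric])
      also have "occ 1 {0..t'} F y \<le> occ 1 {0..<t} F y" using t by (intro occ_mono) (auto simp: t'_def)
      also have "\<dots> = (\<Sum>k. ennreal (a k) * occ 1 {0..<t} (indicator (B k)) y)" by (rule occ_F) simp
      also have "\<dots> \<le> (\<Sum>k. ennreal \<eta> * (ennreal (a k) * occ 1 {0..} (indicator (B k)) y))"
      proof (intro suminf_le summableI)
        fix k
        show "ennreal (a k) * occ 1 {0..<t} (indicator (B k)) y
          \<le> ennreal \<eta> * (ennreal (a k) * occ 1 {0..} (indicator (B k)) y)"
          using mult_left_mono[OF t(2)[of "B k" y], of "ennreal (a k)"] by (simp add: B_def mult_ac)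
      qed
      also have "\<dots> = ennreal \<eta> * occ 1 {0..} F y" by (simp add: occ_F)
      also have "\<dots> \<le> ennreal \<eta> * ennreal 3" by (intro mult_left_mono F_bound) auto
      finally have "occ 0 {0..t'} F y \<le> ennreal (exp 1) * (ennreal \<eta> * ennreal 3)"
        by (simp add: mult_left_mono)
      also have "\<dots> = ennreal (exp 1 * (\<eta> * 3))" using \<eta> by (simp only: ennreal_mult'' mult_nonneg_nonneg less_imp_le zero_le_numeral)
      also have "exp 1 * (\<eta> * 3) = e" by (simp add: \<eta>_def)
      finally show "occ 0 {0..t'} F y \<le> ennreal e" .
    qed (use t in \<open>auto simp: t'_def\<close>)
  qed
  moreover have "\<not> small_ball_kato 1 F"
  proof
    assume "small_ball_kato 1 F"
    then obtain s where s: "0 < s"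
      "\<And>x. occ 1 {0..} (\<lambda>y. indicator (ball x s) y * F y) x \<le> ennreal (1 / 4)"
      unfolding small_ball_kato_def by (meson zero_less_divide_1_iff zero_less_numeral)
    obtain k where "1 / real (Suc k) < s / 2" using s(1) nat_approx_posE[of "s / 2"] by auto
    then have k: "2 * r k < s" by (simp add: r_def)
    \<comment> \<open>The centre of the ball need not have a large potential. By the maximum
      principle some point \<open>z\<close> of the ball has at least half of the supremum, and since
      \<open>2 * r k < s\<close> the ball of radius \<open>s\<close> about \<open>x k + z\<close>
      contains the whole bump.\<close>
    have "\<exists>z\<in>ball 0 (r k). \<not> occ 1 {0..} (indicator (ball (0::'a) (r k))) z \<le> ennreal (c k / 2)"
    proof (rule ccontr)
      assume "\<not> ?thesis"
      then have *: "occ 1 {0..} (indicator (ball (0::'a) (r k))) z \<le> ennreal (c k / 2)" if "z \<in> ball 0 (r k)" for z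
        using that by blast
      have "occ 1 {0..} (\<lambda>y. indicator (ball (0::'a) (r k)) y * 1) z \<le> ennreal (c k / 2)" for z
        by (rule maximum_principle) (use * in auto)
      then have "cc k \<le> ennreal (c k / 2)" unfolding cc_def by (auto intro!: SUP_least)
      then show False using c_pos[of k] by (simp add: c)
    qed
    then obtain z where z: "norm z < r k" "ennreal (c k / 2) \<le> occ 1 {0..} (indicator (ball (0::'a) (r k))) z"
      by (auto simp: not_le intro: less_imp_le)
    have sub: "B k \<subseteq> ball (x k + z) s"
    proof
      fix y assume "y \<in> B k"
      then have "dist (x k) y < r k" by (simp add: B_def)
      moreover have "dist (x k + z) (x k) = norm z" by (simp add: dist_norm)
      ultimately show "y \<in> ball (x k + z) s" using k z dist_triangle[of "x k + z" y "x k"] by simp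
    qed
    have term_le: "ennreal (a k) * indicator (B k) y \<le> F y" for y
    proof -
      have "sum (\<lambda>k. ennreal (a k) * indicator (B k) y) {k} \<le> F y"
        unfolding F_def by (rule sum_le_suminf) auto
      then show ?thesis by (simp only: sum.insert sum.empty finite.emptyI empty_iff not_False_eq_True add_0_right)
    qed
    have "ennreal (1 / 2) = ennreal (a k) * ennreal (c k / 2)"
      using c_pos[of k] by (simp add: a_def ennreal_mult[symmetric])
    also have "\<dots> \<le> ennreal (a k) * occ 1 {0..} (indicator (B k)) (x k + z)"
      unfolding B_shift by (intro mult_left_mono z) auto
    also have "\<dots> = occ 1 {0..} (\<lambda>y. ennreal (a k) * indicator (B k) y) (x k + z)"
      by (rule occ_cmult[symmetric]) auto
    also have "\<dots> \<le> occ 1 {0..} (\<lambda>y. indicator (ball (x k + z) s) y * F y) (x k + z)"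
    proof (rule occ_mono)
      show "ennreal (a k) * indicator (B k) y \<le> indicator (ball (x k + z) s) y * F y" for y
      proof (cases "y \<in> B k")
        case True
        with sub have "y \<in> ball (x k + z) s" by auto
        then show ?thesis using term_le[of y] by simp
      qed simp
    qed simp
    also have "\<dots> \<le> ennreal (1 / 4)" by (rule s)
    finally show False by (subst (asm) ennreal_le_iff) auto
  qed
  moreover have "q \<in> borel_measurable borel" unfolding q_def by measurable
  ultimately show ?thesis by (intro exI[of _ q]) (simp add: q)
qed

section \<open>Regularity of the origin\<close>

lemma entry_markov:
  assumes t: "0 \<le> t" and d: "0 \<le> d" and u: "0 \<le> u"
    and [measurable]: "V \<in> sets borel" "f \<in> borel_measurable borel"
  shows "(\<integral>\<^sup>+\<omega>. indicator (entry x V t d k) \<omega> * f (X (t + real k * d + u) \<omega> - X (t + real k * d) \<omega>) \<partial>M)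
    = (\<integral>\<^sup>+\<omega>. indicator (entry x V t d k) \<omega> * (\<integral>\<^sup>+\<omega>. f (X u \<omega>) \<partial>M) \<partial>M)"
proof -
  obtain B where [measurable]: "\<And>j. B j \<in> sets borel"
    and B: "\<And>\<omega>. \<omega> \<in> space M \<Longrightarrow> indicator {\<omega>. \<forall>j\<le>k. X (t + real j * d) \<omega> \<in> B j} \<omega> = (indicator (entry x V t d k) \<omega> :: ennreal)"
    using entry_cylinder[of V k t d x] by auto
  have mono: "t + real i * d \<le> t + real (Suc i) * d" for i
    using d by (simp add: algebra_simps)
  show ?thesis
    using markov[where k=k and s="\<lambda>k. t + real k * d" and B=B and F="\<lambda>z y. f y" and u=u] t mono u
    by (simp add: B cong: nn_integral_cong)
qed

text \<open>The increment after a grid entrance is independent of the entrance event and has the law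
  of \<open>X u\<close>; the entrance events are disjoint, so their probabilities add up to at most
  \<open>1\<close>.\<close>

lemma jump_after_entry:
  fixes x :: 'a and e :: real
  assumes t: "0 \<le> t" and d: "0 \<le> d" and u: "0 \<le> u" and V[measurable]: "V \<in> sets borel"
  defines "E \<equiv> {\<omega> \<in> space M. \<exists>k. \<omega> \<in> entry x V t d k \<and>
    e < norm (X (t + real k * d + u) \<omega> - X (t + real k * d) \<omega>)}"
  shows "E \<in> sets M" "(\<integral>\<^sup>+\<omega>. indicator E \<omega> \<partial>M) \<le> emeasure M {\<omega> \<in> space M. e < norm (X u \<omega>)}"
proof -
  let ?N = "{y :: 'a. e < norm y}"
  have N[measurable]: "?N \<in> sets borel" by (intro borel_open open_Collect_less continuous_intros)
  have E: "E = (\<Union>k. entry x V t d k \<inter> ((\<lambda>\<omega>. X (t + real k * d + u) \<omega> - X (t + real k * d) \<omega>) -` ?N \<inter> space M))"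
    by (auto simp: E_def)
  show "E \<in> sets M"
    unfolding E
  proof (rule sets.countable_UN'')
    show "entry x V t d k \<inter> ((\<lambda>\<omega>. X (t + real k * d + u) \<omega> - X (t + real k * d) \<omega>) -` ?N \<inter> space M) \<in> sets M" for k
      by (intro sets.Int entry_sets measurable_sets[OF _ N]) measurable
  qed simp
  let ?p = "emeasure M {\<omega> \<in> space M. e < norm (X u \<omega>)}"
  have p: "(\<integral>\<^sup>+\<omega>. indicator ?N (X u \<omega>) \<partial>M) = ?p"
  proof -
    have "(\<integral>\<^sup>+\<omega>. indicator ?N (X u \<omega>) \<partial>M) = (\<integral>\<^sup>+\<omega>. indicator {\<omega> \<in> space M. e < norm (X u \<omega>)} \<omega> \<partial>M)"
      by (intro nn_integral_cong) (auto split: split_indicator)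
    also have "\<dots> = ?p" by (rule nn_integral_indicator) measurable
    finally show ?thesis .
  qed
  have "(\<integral>\<^sup>+\<omega>. indicator E \<omega> \<partial>M) \<le> (\<integral>\<^sup>+\<omega>. (\<Sum>k. indicator (entry x V t d k) \<omega> *
      indicator ?N (X (t + real k * d + u) \<omega> - X (t + real k * d) \<omega>)) \<partial>M)"
  proof (rule nn_integral_mono)
    fix \<omega>
    show "indicator E \<omega> \<le> (\<Sum>k. indicator (entry x V t d k) \<omega> *
      (indicator ?N (X (t + real k * d + u) \<omega> - X (t + real k * d) \<omega>) :: ennreal))"
    proof (cases "\<omega> \<in> E")
      case True
      then obtain k where k: "\<omega> \<in> entry x V t d k"
        "e < norm (X (t + real k * d + u) \<omega> - X (t + real k * d) \<omega>)" by (auto simp: E_def)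
      then show ?thesis unfolding suminf_entry(1)[OF k(1)] by (simp add: indicator_def)
    qed simp
  qed
  also have "\<dots> = (\<Sum>k. \<integral>\<^sup>+\<omega>. indicator (entry x V t d k) \<omega> *
      indicator ?N (X (t + real k * d + u) \<omega> - X (t + real k * d) \<omega>) \<partial>M)"
    by (rule nn_integral_suminf) measurable
  also have "\<dots> = (\<Sum>k. \<integral>\<^sup>+\<omega>. indicator (entry x V t d k) \<omega> * ?p \<partial>M)"
    using t d u by (subst entry_markov) (auto simp: p)
  also have "\<dots> = (\<integral>\<^sup>+\<omega>. (\<Sum>k. indicator (entry x V t d k) \<omega> * ?p) \<partial>M)"
    by (rule nn_integral_suminf[symmetric]) measurable
  also have "\<dots> \<le> (\<integral>\<^sup>+\<omega>. ?p \<partial>M)"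
  proof (rule nn_integral_mono)
    fix \<omega>
    show "(\<Sum>k. indicator (entry x V t d k) \<omega> * ?p) \<le> ?p"
    proof (cases "\<exists>k. \<omega> \<in> entry x V t d k")
      case True
      then obtain k where k: "\<omega> \<in> entry x V t d k" by auto
      show ?thesis unfolding suminf_entry(1)[OF k] by simp
    qed (simp add: suminf_entry(2))
  qed
  also have "\<dots> = ?p" by (simp add: emeasure_space_1)
  finally show "(\<integral>\<^sup>+\<omega>. indicator E \<omega> \<partial>M) \<le> ?p" .
qed

text \<open>The intersection over \<open>j\<close> is the measurable event that the path comes
  arbitrarily close to \<open>0\<close> in the window. It stands in for an exact visit, whose event
  need not be measurable.\<close>

definition zero_hits :: "nat \<Rightarrow> real \<Rightarrow> real \<Rightarrow> 'w set" where
  "zero_hits j t h = hits 0 (ball 0 (1 / real (Suc j))) t h"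

lemma zero_hits_sets[measurable]: "zero_hits j t h \<in> sets M"
  unfolding zero_hits_def by (intro hits_sets) simp

text \<open>
  Quasi-left-continuity at the limit of the entrance times into the balls around \<open>0\<close>: a path that approaches \<open>0\<close>
  without reaching it would have to jump by a fixed amount within an arbitrarily short time \<open>1 / (l + 1)\<close> after a
  grid entrance, which \<open>jump_after_entry\<close> makes improbable.
\<close>

lemma approach_zero_jump:
  assumes \<omega>: "\<And>j. \<omega> \<in> zero_hits j t h" and nz: "\<And>u. t \<le> u \<Longrightarrow> u \<le> h \<Longrightarrow> X u \<omega> \<noteq> 0"
  shows "\<exists>i. \<forall>\<^sub>F l in sequentially. \<forall>\<^sub>F j in sequentially. \<forall>\<^sub>F m in sequentially.
    \<exists>k. \<omega> \<in> entry 0 (ball 0 (1 / real (Suc j))) t (1 / real (Suc m)) k \<and>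
      1 / real (Suc i) < norm (X (t + real k * (1 / real (Suc m)) + 1 / real (Suc l)) \<omega>
        - X (t + real k * (1 / real (Suc m))) \<omega>)"
proof -
  let ?d = "\<lambda>m. 1 / real (Suc m)"
  have d0: "?d \<longlonglongrightarrow> 0" by (rule LIMSEQ_Suc[OF lim_1_over_n])
  define H where "H j = {u. t \<le> u \<and> u < h \<and> norm (X u \<omega>) < ?d j}" for j
  have H_ne: "H j \<noteq> {}" for j
    using \<omega>[of j] by (auto simp: zero_hits_def hits_def H_def)
  have sp: "\<omega> \<in> space M" using \<omega>[of 0] by (auto simp: zero_hits_def hits_def)
  have bdd: "bdd_below (H j)" for j by (auto simp: H_def bdd_below_def)
  \<comment> \<open>\<open>T j\<close> is the entrance time into the ball of index \<open>j\<close>.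
    These times increase to \<open>S\<close>, where the path is nonzero by assumption.\<close>
  define T where "T j = Inf (H j)" for j
  have H_anti: "H j' \<subseteq> H j" if "j \<le> j'" for j j'
  proof -
    have "?d j' \<le> ?d j" using that by (auto intro!: divide_left_mono)
    then show ?thesis by (auto simp: H_def)
  qed
  have T_mono: "T j \<le> T j'" if "j \<le> j'" for j j'
    unfolding T_def by (rule cInf_superset_mono[OF H_ne bdd H_anti[OF that]])
  have T_t: "t \<le> T j" for j unfolding T_def by (rule cInf_greatest[OF H_ne]) (auto simp: H_def)
  have T_h: "T j \<le> h" for j
  proof -
    obtain u where u: "u \<in> H j" using H_ne by blast
    then have "T j \<le> u" unfolding T_def by (intro cInf_lower bdd)
    then show ?thesis using u by (auto simp: H_def)
  qed
  have X_T: "norm (X (T j) \<omega>) \<le> ?d j" for j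
  proof (rule ccontr)
    assume "\<not> ?thesis"
    then have far: "?d j < norm (X (T j) \<omega>)" by simp
    have "open {z :: 'a. ?d j < norm z}" by (intro open_Collect_less continuous_intros)
    from eventually_in_open[OF this, of 0 "T j" \<omega>] far
    obtain b where b: "T j < b" "\<And>y. T j < y \<Longrightarrow> y < b \<Longrightarrow> ?d j < norm (X y \<omega>)" by auto
    have "b \<le> u" if u: "u \<in> H j" for u
    proof (rule ccontr)
      assume "\<not> b \<le> u"
      moreover have "T j \<le> u" using u unfolding T_def by (intro cInf_lower bdd)
      ultimately have "?d j < norm (X u \<omega>)" using b far by (cases "u = T j") auto
      then show False using u by (simp add: H_def)
    qed
    then have "b \<le> T j" unfolding T_def by (intro cInf_greatest H_ne)
    then show False using b by simp
  qed
  define S where "S = (SUP j. T j)"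
  have bddT: "bdd_above (range T)" using T_h by (auto simp: bdd_above_def)
  have T_S: "T j \<le> S" for j unfolding S_def by (intro cSUP_upper bddT) simp
  have S_h: "S \<le> h" unfolding S_def using T_h by (intro cSUP_least) auto
  have T_lim: "T \<longlonglongrightarrow> S" unfolding S_def
    by (rule LIMSEQ_incseq_SUP[OF bddT]) (auto simp: incseq_def T_mono)
  have nzS: "X S \<omega> \<noteq> 0" using nz[OF order_trans[OF T_t T_S] S_h] .
  \<comment> \<open>If some \<open>T j\<close> equalled \<open>S\<close>, so would all later
    entrance times, and \<open>X_T\<close> would force \<open>X S \<omega> = 0\<close>.\<close>
  have T_less: "T j < S" for j
  proof (rule ccontr)
    assume "\<not> ?thesis"
    then have eq: "T j = S" using T_S[of j] by simp
    have "norm (X S \<omega>) \<le> ?d j'" if "j \<le> j'" for j'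
      using T_mono[OF that] T_S[of j'] X_T[of j'] eq by simp
    then have "norm (X S \<omega>) \<le> 0"
      by (intro tendsto_lowerbound[OF d0] eventually_sequentiallyI[of j]) auto
    then show False using nzS by simp
  qed
  \<comment> \<open>The norm exceeds \<open>2 * ?d i\<close> at \<open>S\<close> and shortly after,
    and is below \<open>?d i\<close> at entrances of large index \<open>j\<close>; the difference is
    the jump.\<close>
  obtain i where i: "?d i < norm (X S \<omega>) / 2" using nzS nat_approx_posE[of "norm (X S \<omega>) / 2"] by auto
  have "open {z :: 'a. 2 * ?d i < norm z}" by (intro open_Collect_less continuous_intros)
  from eventually_in_open[OF this, of 0 S \<omega>] i
  obtain b where b: "S < b" "\<And>y. S < y \<Longrightarrow> y < b \<Longrightarrow> 2 * ?d i < norm (X y \<omega>)" by auto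
  have "\<forall>\<^sub>F l in sequentially. ?d l < b - S" using b(1) by (intro order_tendstoD(2)[OF d0]) simp
  then have "\<forall>\<^sub>F l in sequentially. \<forall>\<^sub>F j in sequentially. \<forall>\<^sub>F m in sequentially.
    \<exists>k. \<omega> \<in> entry 0 (ball 0 (?d j)) t (?d m) k \<and>
      ?d i < norm (X (t + real k * ?d m + ?d l) \<omega> - X (t + real k * ?d m) \<omega>)"
  proof eventually_elim
    \<comment> \<open>The delay \<open>?d l\<close> is chosen first, then \<open>j\<close> with
      \<open>T j\<close> closer to \<open>S\<close> than the delay, then a mesh fine enough to enter
      before \<open>S\<close>. The entrance \<open>s\<close> lies between \<open>T j\<close> and
      \<open>S\<close>, so \<open>s + ?d l\<close> falls between \<open>S\<close> and
      \<open>b\<close>.\<close>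
    case l: (elim l)
    have "\<forall>\<^sub>F j in sequentially. S - ?d l < T j"
      by (intro order_tendstoD(1)[OF T_lim]) simp
    moreover have "\<forall>\<^sub>F j in sequentially. ?d j < ?d i"
      by (intro order_tendstoD(2)[OF d0]) simp
    ultimately show ?case
    proof eventually_elim
      case j: (elim j)
      obtain v where v: "v \<in> H j" "v < S"
        using T_less[of j] cInf_less_iff[OF H_ne bdd] unfolding T_def by blast
      have "\<forall>\<^sub>F m in sequentially. \<exists>k. v < t + real k * ?d m \<and> t + real k * ?d m < S
          \<and> 0 + X (t + real k * ?d m) \<omega> \<in> ball 0 (?d j)"
        using v by (intro grid_hit) (auto simp: H_def)
      then show ?case
      proof eventually_elim
        case (elim m)
        then obtain k where k: "t + real k * ?d m < S" "0 + X (t + real k * ?d m) \<omega> \<in> ball 0 (?d j)" by auto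
        obtain k' where k': "k' \<le> k" "\<omega> \<in> entry 0 (ball 0 (?d j)) t (?d m) k'"
          using entry_exists[OF sp k(2)] .
        define s where "s = t + real k' * ?d m"
        have "real k' * ?d m \<le> real k * ?d m" using k' by (intro mult_right_mono) auto
        then have s_less: "s < S" using k(1) by (simp add: s_def)
        have Xs: "norm (X s \<omega>) < ?d j" using k'(2) by (simp add: entry_def s_def)
        have "t \<le> s" by (simp add: s_def)
        then have "s \<in> H j" using s_less S_h Xs by (simp add: H_def)
        then have "T j \<le> s" unfolding T_def by (intro cInf_lower bdd)
        then have "S < s + ?d l" "s + ?d l < b" using j(1) l s_less by linarith+
        then have "2 * ?d i < norm (X (s + ?d l) \<omega>)" by (rule b(2))
        moreover have "norm (X (s + ?d l) \<omega>) \<le> norm (X (s + ?d l) \<omega> - X s \<omega>) + norm (X s \<omega>)"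
          using norm_triangle_sub[of "X (s + ?d l) \<omega>" "X s \<omega>"] by (simp add: add.commute)
        ultimately have "?d i < norm (X (s + ?d l) \<omega> - X s \<omega>)" using Xs j(2) by linarith
        then show ?case using k'(2) unfolding s_def by blast
      qed
    qed
  qed
  then show ?thesis by blast
qed

text \<open>By \<open>approach_zero_jump\<close> an exceptional path has
  \<open>G i \<omega> \<ge> 1\<close> for some \<open>i\<close>, whereas Fatou, applied three times,
  bounds the integral of \<open>G i\<close> by the limit of \<open>?p i l\<close> in
  \<open>l\<close>, which is \<open>0\<close>. The visit may take place at \<open>h\<close> itself,
  as a limit of times before \<open>h\<close>.\<close>

lemma AE_zero_of_approach:
  assumes t: "0 \<le> t"
  shows "AE \<omega> in M. (\<forall>j. \<omega> \<in> zero_hits j t h) \<longrightarrow> (\<exists>u. t \<le> u \<and> u \<le> h \<and> X u \<omega> = 0)"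
proof -
  let ?d = "\<lambda>m. 1 / real (Suc m)"
  define E where "E i l j m = {\<omega> \<in> space M. \<exists>k. \<omega> \<in> entry 0 (ball 0 (?d j)) t (?d m) k \<and>
    ?d i < norm (X (t + real k * ?d m + ?d l) \<omega> - X (t + real k * ?d m) \<omega>)}" for i l j m
  define G where "G i \<omega> = liminf (\<lambda>l. liminf (\<lambda>j. liminf (\<lambda>m. indicator (E i l j m) \<omega> :: ennreal)))" for i \<omega>
  let ?p = "\<lambda>i l. emeasure M {\<omega> \<in> space M. ?d i < norm (X (?d l) \<omega>)}"
  have E_sets[measurable]: "E i l j m \<in> sets M" for i l j m
    unfolding E_def using t by (intro jump_after_entry) auto
  have E_prob: "(\<integral>\<^sup>+\<omega>. indicator (E i l j m) \<omega> \<partial>M) \<le> ?p i l" for i l j m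
    unfolding E_def using t by (intro jump_after_entry) auto
  have [measurable]: "G i \<in> borel_measurable M" for i unfolding G_def by measurable
  have "(\<integral>\<^sup>+\<omega>. G i \<omega> \<partial>M) = 0" for i
  proof -
    have p_lim: "(\<lambda>l. prob {\<omega> \<in> space M. ?d i < norm (X (?d l) \<omega>)}) \<longlonglongrightarrow> 0"
    proof (rule order_tendstoI)
      fix e :: real assume "0 < e"
      then obtain h where h: "0 < h" "prob (hits 0 {z. ?d i < norm z} 0 h) < e"
        using prob_exit_small[of "?d i" e] by auto
      have "\<forall>\<^sub>F l in sequentially. ?d l < h"
        using h by (intro order_tendstoD(2)[OF LIMSEQ_Suc[OF lim_1_over_n]])
      then show "\<forall>\<^sub>F l in sequentially. prob {\<omega> \<in> space M. ?d i < norm (X (?d l) \<omega>)} < e"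
      proof eventually_elim
        case (elim l)
        then have "{\<omega> \<in> space M. ?d i < norm (X (?d l) \<omega>)} \<subseteq> hits 0 {z. ?d i < norm z} 0 h"
          by (auto simp: hits_def intro!: bexI[of _ "?d l"])
        then have "prob {\<omega> \<in> space M. ?d i < norm (X (?d l) \<omega>)} \<le> prob (hits 0 {z. ?d i < norm z} 0 h)"
          by (intro finite_measure_mono hits_sets open_Collect_less continuous_intros)
        then show ?case using h by simp
      qed
    qed (auto intro!: always_eventually intro: order.strict_trans2[OF _ measure_nonneg])
    then have "(\<lambda>l. ?p i l) \<longlonglongrightarrow> ennreal 0"
      unfolding emeasure_eq_measure by (rule tendsto_ennrealI)
    then have "liminf (\<lambda>l. ?p i l) = 0"
      using lim_imp_Liminf[of sequentially "?p i" "ennreal 0"] by simp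
    have "(\<integral>\<^sup>+\<omega>. G i \<omega> \<partial>M) \<le> liminf (\<lambda>l. \<integral>\<^sup>+\<omega>. liminf (\<lambda>j. liminf (\<lambda>m. indicator (E i l j m) \<omega>)) \<partial>M)"
      unfolding G_def by (rule nn_integral_liminf) measurable
    also have "\<dots> \<le> liminf (\<lambda>l. ?p i l)"
    proof (intro Liminf_mono always_eventually allI)
      fix l
      have "(\<integral>\<^sup>+\<omega>. liminf (\<lambda>j. liminf (\<lambda>m. indicator (E i l j m) \<omega>)) \<partial>M)
        \<le> liminf (\<lambda>j. \<integral>\<^sup>+\<omega>. liminf (\<lambda>m. indicator (E i l j m) \<omega>) \<partial>M)"
        by (rule nn_integral_liminf) measurable
      also have "\<dots> \<le> ?p i l"
      proof (intro Liminf_le always_eventually allI)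
        fix j
        have "(\<integral>\<^sup>+\<omega>. liminf (\<lambda>m. indicator (E i l j m) \<omega>) \<partial>M)
          \<le> liminf (\<lambda>m. \<integral>\<^sup>+\<omega>. indicator (E i l j m) \<omega> \<partial>M)"
          by (rule nn_integral_liminf) measurable
        also have "\<dots> \<le> ?p i l" using E_prob by (intro Liminf_le always_eventually) auto
        finally show "(\<integral>\<^sup>+\<omega>. liminf (\<lambda>m. indicator (E i l j m) \<omega>) \<partial>M) \<le> ?p i l" .
      qed simp
      finally show "(\<integral>\<^sup>+\<omega>. liminf (\<lambda>j. liminf (\<lambda>m. indicator (E i l j m) \<omega>)) \<partial>M) \<le> ?p i l" .
    qed
    also have "\<dots> = 0" by fact
    finally show ?thesis by simp
  qed
  then have "AE \<omega> in M. \<forall>i. G i \<omega> = 0"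
    by (auto simp: AE_all_countable nn_integral_0_iff_AE)
  with AE_space show ?thesis
  proof eventually_elim
    case (elim \<omega>)
    show ?case
    proof (intro impI, rule ccontr)
      assume "\<forall>j. \<omega> \<in> zero_hits j t h" "\<not> (\<exists>u. t \<le> u \<and> u \<le> h \<and> X u \<omega> = 0)"
      then obtain i where "\<forall>\<^sub>F l in sequentially. \<forall>\<^sub>F j in sequentially. \<forall>\<^sub>F m in sequentially.
        \<exists>k. \<omega> \<in> entry 0 (ball 0 (?d j)) t (?d m) k \<and>
          ?d i < norm (X (t + real k * ?d m + ?d l) \<omega> - X (t + real k * ?d m) \<omega>)"
        using approach_zero_jump[of \<omega> t h] by blast
      then have "\<forall>\<^sub>F l in sequentially. \<forall>\<^sub>F j in sequentially. \<forall>\<^sub>F m in sequentially. 1 \<le> (indicator (E i l j m) \<omega> :: ennreal)"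
        by (rule eventually_mono, elim eventually_mono) (use elim in \<open>auto simp: E_def\<close>)
      then have "\<forall>\<^sub>F l in sequentially. 1 \<le> liminf (\<lambda>j. liminf (\<lambda>m. indicator (E i l j m) \<omega> :: ennreal))"
        by (rule eventually_mono) (intro Liminf_bounded, elim eventually_mono, rule Liminf_bounded)
      then have "1 \<le> G i \<omega>" unfolding G_def by (rule Liminf_bounded)
      then show False using elim by simp
    qed
  qed
qed

section \<open>Regularity in terms of return probabilities to small balls\<close>

definition zero_regular :: bool where
  "zero_regular \<longleftrightarrow> (AE \<omega> in M. \<forall>h>0. \<exists>u. 0 < u \<and> u < h \<and> X u \<omega> = 0)"

text \<open>Almost every path has a zero in some window \<open>{1 / (n + 1)..<h}\<close>, so the
  events \<open>Z n\<close> increase to probability one. Since \<open>Z n\<close> concerns all balls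
  at once, \<open>t\<close> does not depend on the radius.\<close>

lemma zero_regular_return:
  assumes reg: zero_regular and h: "0 < h" and p: "p < 1"
  shows "\<exists>t>0. \<forall>r>0. p \<le> prob (hits 0 (ball 0 r) t h)"
proof -
  let ?d = "\<lambda>m. 1 / real (Suc m)"
  define Z where "Z n = (\<Inter>j. zero_hits j (?d n) h)" for n
  have [measurable]: "Z n \<in> sets M" for n unfolding Z_def by measurable
  have "(\<lambda>n. prob (Z n)) \<longlonglongrightarrow> prob (\<Union>n. Z n)"
  proof (rule finite_Lim_measure_incseq)
    show "incseq Z"
      unfolding incseq_def Z_def zero_hits_def
      by (intro allI impI INF_mono' hits_mono) (auto intro!: divide_left_mono)
  qed auto
  moreover have "prob (\<Union>n. Z n) = 1"
  proof (subst prob_eq_1)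
    show "AE \<omega> in M. \<omega> \<in> (\<Union>n. Z n)"
      using reg[unfolded zero_regular_def] AE_space
    proof eventually_elim
      case (elim \<omega>)
      then obtain u where u: "0 < u" "u < h" "X u \<omega> = 0" using h by blast
      obtain n where "?d n < u" using u(1) by (metis nat_approx_posE)
      then have "\<omega> \<in> Z n" using u elim by (auto simp: Z_def zero_hits_def hits_def intro!: bexI[of _ u])
      then show ?case by blast
    qed
  qed measurable
  ultimately have "\<forall>\<^sub>F n in sequentially. p < prob (Z n)" using p by (intro order_tendstoD) auto
  then obtain n where n: "p < prob (Z n)" by (auto simp: eventually_sequentially)
  show ?thesis
  proof (intro exI[of _ "?d n"] conjI allI impI)
    fix r :: real assume "0 < r"
    then obtain j where "?d j < r" by (metis nat_approx_posE)
    then have "Z n \<subseteq> hits 0 (ball 0 r) (?d n) h"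
      unfolding Z_def zero_hits_def by (intro INF_lower2[of j] hits_mono) auto
    then have "prob (Z n) \<le> prob (hits 0 (ball 0 r) (?d n) h)"
      by (intro finite_measure_mono hits_sets) auto
    then show "p \<le> prob (hits 0 (ball 0 r) (?d n) h)" using n by simp
  qed simp
qed

text \<open>If approaching \<open>0\<close> in some window before \<open>1 / (m + 1)\<close> were
  almost sure for every \<open>m\<close>, \<open>AE_zero_of_approach\<close> would give zeros at
  arbitrarily small times. So for some \<open>m\<close> the union of these events over all windows
  has probability below \<open>1\<close>; it bounds every single window, which gives the uniformity
  in \<open>t\<close>.\<close>

lemma not_zero_regular_escape:
  assumes "\<not> zero_regular"
  shows "\<exists>h>0. \<exists>p<1. \<forall>t>0. \<exists>r>0. prob (hits 0 (ball 0 r) t h) \<le> p"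
proof -
  let ?d = "\<lambda>m. 1 / real (Suc m)"
  define Z where "Z n h = (\<Inter>j. zero_hits j (?d n) h)" for n h
  have [measurable]: "Z n h \<in> sets M" for n h unfolding Z_def by measurable
  have "\<exists>m. prob (\<Union>n. Z n (?d m)) < 1"
  proof (rule ccontr)
    assume "\<not> ?thesis"
    then have "prob (\<Union>n. Z n (?d m)) = 1" for m using prob_le_1 by (metis antisym not_le)
    then have "AE \<omega> in M. \<omega> \<in> (\<Union>n. Z n (?d m))" for m by (subst (asm) prob_eq_1) auto
    then have "AE \<omega> in M. \<forall>m. \<omega> \<in> (\<Union>n. Z n (?d m))" unfolding AE_all_countable by blast
    moreover have "AE \<omega> in M. \<forall>n m. (\<forall>j. \<omega> \<in> zero_hits j (?d n) (?d m)) \<longrightarrow> (\<exists>u. ?d n \<le> u \<and> u \<le> ?d m \<and> X u \<omega> = 0)"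
      unfolding AE_all_countable by (intro allI AE_zero_of_approach) simp
    ultimately have "AE \<omega> in M. \<forall>h>0. \<exists>u. 0 < u \<and> u < h \<and> X u \<omega> = 0"
    proof eventually_elim
      case (elim \<omega>)
      show ?case
      proof (intro allI impI)
        fix h :: real assume "0 < h"
        then obtain m where m: "?d m < h" by (metis nat_approx_posE)
        from elim(1) obtain n where "\<omega> \<in> Z n (?d m)" by blast
        then have "\<forall>j. \<omega> \<in> zero_hits j (?d n) (?d m)" by (auto simp: Z_def)
        with elim(2) obtain u where u: "?d n \<le> u" "u \<le> ?d m" "X u \<omega> = 0" by blast
        have "0 < ?d n" by simp
        with u m have "0 < u \<and> u < h" by linarith
        with u show "\<exists>u. 0 < u \<and> u < h \<and> X u \<omega> = 0" by blast
      qed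
    qed
    then show False using assms by (simp add: zero_regular_def)
  qed
  then obtain m where m: "prob (\<Union>n. Z n (?d m)) < 1" by blast
  \<comment> \<open>A midpoint, strictly above the probability of the union, because the ball events
    only decrease to \<open>Z n\<close> as the radius shrinks.\<close>
  define p where "p = (prob (\<Union>n. Z n (?d m)) + 1) / 2"
  have p: "p < 1" "prob (\<Union>n. Z n (?d m)) < p" using m by (auto simp: p_def)
  have "\<exists>r>0. prob (hits 0 (ball 0 r) t (?d m)) \<le> p" if t: "0 < t" for t
  proof -
    obtain n where n: "?d n < t" using t by (metis nat_approx_posE)
    have "(\<lambda>j. prob (zero_hits j (?d n) (?d m))) \<longlonglongrightarrow> prob (Z n (?d m))"
      unfolding Z_def
    proof (rule finite_Lim_measure_decseq)
      show "decseq (\<lambda>j. zero_hits j (?d n) (?d m))"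
        unfolding decseq_def zero_hits_def
        by (intro allI impI hits_mono subset_ball) (auto intro!: divide_left_mono)
    qed auto
    moreover have "prob (Z n (?d m)) < p"
    proof -
      have "prob (Z n (?d m)) \<le> prob (\<Union>n. Z n (?d m))" by (intro finite_measure_mono) auto
      then show ?thesis using p by simp
    qed
    ultimately have "\<forall>\<^sub>F j in sequentially. prob (zero_hits j (?d n) (?d m)) < p"
      by (intro order_tendstoD)
    then obtain j where j: "prob (zero_hits j (?d n) (?d m)) < p" by (auto simp: eventually_sequentially)
    have "hits 0 (ball 0 (?d j)) t (?d m) \<subseteq> zero_hits j (?d n) (?d m)"
      unfolding zero_hits_def using n by (intro hits_mono) auto
    then have "prob (hits 0 (ball 0 (?d j)) t (?d m)) \<le> prob (zero_hits j (?d n) (?d m))"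
      by (intro finite_measure_mono) auto
    then show ?thesis using j by (intro exI[of _ "?d j"]) auto
  qed
  then show ?thesis using p by (intro exI[of _ "?d m"]) auto
qed

end

section \<open>Transfer to the original process\<close>

text \<open>Independence is read off from the joint law, which almost sure changes do not affect.
  The product-measure criterion asks for a nonempty index set; hence \<open>Suc n\<close> in
  \<open>X_indep\<close>.\<close>

lemma (in prob_space) indep_vars_cong_AE:
  assumes I: "I \<noteq> {}" and ind: "indep_vars N D I"
    and eq: "AE \<omega> in M. \<forall>i\<in>I. D i \<omega> = D' i \<omega>" and [measurable]: "\<And>i. i \<in> I \<Longrightarrow> D' i \<in> M \<rightarrow>\<^sub>M N i"
  shows "indep_vars N D' I"
proof -
  have [measurable]: "D i \<in> M \<rightarrow>\<^sub>M N i" if "i \<in> I" for i using ind that by (auto simp: indep_vars_def)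
  have "distr M (PiM I N) (\<lambda>x. \<lambda>i\<in>I. D' i x) = distr M (PiM I N) (\<lambda>x. \<lambda>i\<in>I. D i x)"
  proof (rule distr_cong_AE)
    show "AE x in M. (\<lambda>i\<in>I. D' i x) = (\<lambda>i\<in>I. D i x)"
      using eq by eventually_elim auto
  qed (auto intro!: measurable_restrict)
  also have "\<dots> = PiM I (\<lambda>i. distr M (N i) (D i))"
    using ind I by (subst (asm) indep_vars_iff_distr_eq_PiM') auto
  also have "\<dots> = PiM I (\<lambda>i. distr M (N i) (D' i))"
  proof (rule PiM_cong)
    fix i assume i: "i \<in> I"
    show "distr M (N i) (D i) = distr M (N i) (D' i)"
      using i eq by (intro distr_cong_AE) (auto elim: eventually_mono)
  qed simp
  finally show ?thesis using I by (subst indep_vars_iff_distr_eq_PiM') auto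
qed

lemma (in levy_process) right_continuous_version:
  obtains Y where "right_continuous_levy M Y" "AE \<omega> in M. \<forall>t\<ge>0. X t \<omega> = Y t \<omega>"
proof -
  have "AE \<omega> in M. X 0 \<omega> = 0 \<and> (\<forall>t\<ge>0. ((\<lambda>s. X s \<omega>) \<longlongrightarrow> X t \<omega>) (at_right t))"
    using start_zero cadlag by eventually_elim auto
  then obtain N where N: "N \<in> null_sets M"
    "\<And>\<omega>. \<omega> \<in> space M - N \<Longrightarrow> X 0 \<omega> = 0 \<and> (\<forall>t\<ge>0. ((\<lambda>s. X s \<omega>) \<longlongrightarrow> X t \<omega>) (at_right t))"
    unfolding eventually_ae_filter by blast
  have [measurable]: "N \<in> sets M" using N by auto
  \<comment> \<open>Off the null set \<open>N\<close> nothing changes at times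
    \<open>t \<ge> 0\<close>, since \<open>X 0\<close> vanishes there; on \<open>N\<close> the zero
    path is trivially right-continuous.\<close>
  define Y where "Y t \<omega> = (if 0 < t then indicator (space M - N) \<omega> *\<^sub>R X t \<omega> else 0)" for t \<omega>
  have good: "X t \<omega> = Y t \<omega>" if "0 \<le> t" "\<omega> \<in> space M - N" for t \<omega>
    using that N(2) by (cases "t = 0") (auto simp: Y_def)
  have "AE \<omega> in M. \<omega> \<notin> N" using N(1) by (rule AE_not_in)
  with AE_space have eq: "AE \<omega> in M. \<forall>t\<ge>0. X t \<omega> = Y t \<omega>"
    by eventually_elim (use good in auto)
  have X_meas: "X t \<in> borel_measurable M" if "0 < t" for t
    using that by (intro random_variable_X) simp
  have Y_meas: "Y t \<in> borel_measurable M" for t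
    unfolding Y_def using X_meas by (cases "0 < t") simp_all
  have "right_continuous_levy M Y"
  proof
    show "Y t \<in> borel_measurable M" for t by (rule Y_meas)
    show "t \<le> 0 \<Longrightarrow> Y t \<omega> = 0" for t \<omega> by (simp add: Y_def)
    show "\<omega> \<notin> space M \<Longrightarrow> Y t \<omega> = 0" for t \<omega> by (simp add: Y_def)
    show "((\<lambda>s. Y s \<omega>) \<longlongrightarrow> Y t \<omega>) (at_right t)" for t \<omega>
    proof (cases "0 \<le> t \<and> \<omega> \<in> space M - N")
      case True
      then have "((\<lambda>s. X s \<omega>) \<longlongrightarrow> Y t \<omega>) (at_right t)" using N(2)[of \<omega>] good[of t \<omega>] by auto
      moreover have "\<forall>\<^sub>F s in at_right t. X s \<omega> = Y s \<omega>"
        using eventually_at_right_less[of t] by eventually_elim (use True good in auto)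
      ultimately show ?thesis by (rule Lim_transform_eventually)
    next
      case False
      have "\<forall>\<^sub>F s in at_right t. 0 = Y s \<omega>"
      proof (cases "0 \<le> t")
        case True
        with False show ?thesis by (auto simp: Y_def)
      next
        case neg: False
        then have "\<forall>s>t. s < 0 \<longrightarrow> 0 = Y s \<omega>" by (simp add: Y_def)
        with neg show ?thesis unfolding eventually_at_right_field by (intro exI[of _ 0]) auto
      qed
      moreover have "Y t \<omega> = 0" using False by (auto simp: Y_def)
      ultimately show ?thesis by (intro Lim_transform_eventually[OF tendsto_const]) auto
    qed
    show "indep_vars (\<lambda>_. borel) (\<lambda>i \<omega>. Y (t (Suc i)) \<omega> - Y (t i) \<omega>) {..<Suc n}"
      if t: "0 \<le> t 0" "\<And>i. i < Suc n \<Longrightarrow> t i \<le> t (Suc i)" for n t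
    proof (rule indep_vars_cong_AE)
      show "indep_vars (\<lambda>_. borel) (\<lambda>i \<omega>. X (t (Suc i)) \<omega> - X (t i) \<omega>) {..<Suc n}"
        using t by (rule indep_increments)
      have "0 \<le> t i" if "i \<le> Suc n" for i
        using that by (induction i) (use t in \<open>auto intro: order_trans\<close>)
      then have "0 \<le> t i \<and> 0 \<le> t (Suc i)" if "i < Suc n" for i
        using that by auto
      then show "AE \<omega> in M. \<forall>i\<in>{..<Suc n}. X (t (Suc i)) \<omega> - X (t i) \<omega> = Y (t (Suc i)) \<omega> - Y (t i) \<omega>"
        using eq by (auto elim!: eventually_mono)
    qed (use Y_meas in auto)
    show "distr M borel (\<lambda>\<omega>. Y (s + t) \<omega> - Y s \<omega>) = distr M borel (Y t)" if "0 \<le> s" "0 \<le> t" for s t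
    proof -
      have "distr M borel (\<lambda>\<omega>. Y (s + t) \<omega> - Y s \<omega>) = distr M borel (\<lambda>\<omega>. X (s + t) \<omega> - X s \<omega>)"
        using eq that Y_meas random_variable_X by (intro distr_cong_AE) (auto elim!: eventually_mono)
      also have "\<dots> = distr M borel (X t)" using that by (rule stationary_increments)
      also have "\<dots> = distr M borel (Y t)"
        using eq that Y_meas random_variable_X by (intro distr_cong_AE) (auto elim!: eventually_mono)
      finally show ?thesis .
    qed
  qed
  with eq show ?thesis using that by blast
qed

section \<open>The original conditions expressed through the normalised process\<close>

context
  fixes M :: "'w measure" and X Y :: "real \<Rightarrow> 'w \<Rightarrow> real ^ 'n"
  assumes Y: "right_continuous_levy M Y" and eq: "AE \<omega> in M. \<forall>t\<ge>0. X t \<omega> = Y t \<omega>"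
begin

interpretation Y: right_continuous_levy M Y by (rule Y)

lemma condition_I_iff: "condition_I M X q \<longleftrightarrow> Y.small_time_kato (\<lambda>y. ennreal \<bar>q y\<bar>)"
proof -
  have "expectation_from M X x (\<lambda>Y. \<integral>\<^sup>+u\<in>{0..t}. ennreal \<bar>q (Y u)\<bar> \<partial>lborel)
    = Y.occ 0 {0..t} (\<lambda>y. ennreal \<bar>q y\<bar>) x" for x t
    unfolding expectation_from_def Y.occ_def
  proof (rule nn_integral_cong_AE, use eq in eventually_elim)
    case (elim \<omega>)
    then show ?case by (intro nn_integral_cong) (auto split: split_indicator)
  qed
  then show ?thesis
    unfolding condition_I_def Y.small_time_kato_def
    by (simp, intro SUP_tendsto_0_at_right_iff Y.occ_mono) auto
qed

lemma condition_II_iff: "condition_II M X l q \<longleftrightarrow> Y.small_ball_kato l (\<lambda>y. ennreal \<bar>q y\<bar>)"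
proof -
  have "expectation_from M X x (\<lambda>Y. \<integral>\<^sup>+u\<in>{0..}. ennreal (exp (- l * u) * indicator (ball x r) (Y u) * \<bar>q (Y u)\<bar>) \<partial>lborel)
    = Y.occ l {0..} (\<lambda>y. indicator (ball x r) y * ennreal \<bar>q y\<bar>) x" for x r
    unfolding expectation_from_def Y.occ_def
  proof (rule nn_integral_cong_AE, use eq in eventually_elim)
    case (elim \<omega>)
    then show ?case by (intro nn_integral_cong) (auto simp: ennreal_mult split: split_indicator)
  qed
  moreover have "indicator (ball x s) y * ennreal \<bar>q y\<bar> \<le> indicator (ball x r) y * ennreal \<bar>q y\<bar>"
    if "s \<le> r" for s r x y
    using that by (auto split: split_indicator)
  ultimately show ?thesis
    unfolding condition_II_def Y.small_ball_kato_def
    by (simp, intro SUP_tendsto_0_at_right_iff Y.occ_mono) auto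
qed

lemma regular_for_iff: "regular_for M X 0 {0} \<longleftrightarrow> Y.zero_regular"
proof -
  have "hitting_time (\<lambda>t. 0 + X t \<omega>) {0} = 0 \<longleftrightarrow> (\<forall>h>0. \<exists>u. 0 < u \<and> u < h \<and> Y u \<omega> = 0)"
    if *: "\<forall>t\<ge>0. X t \<omega> = Y t \<omega>" for \<omega>
  proof -
    let ?S = "ereal ` {t. 0 < t \<and> 0 + X t \<omega> \<in> {0}}"
    have nonneg: "0 \<le> Inf ?S" by (auto intro!: Inf_greatest)
    have "Inf ?S = 0 \<longleftrightarrow> (\<forall>h>0. Inf ?S < ereal h)"
    proof
      assume small: "\<forall>h>0. Inf ?S < ereal h"
      have "Inf ?S \<le> 0"
        by (rule ereal_le_epsilon2) (use small in \<open>auto simp: less_imp_le zero_ereal_def[symmetric]\<close>)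
      with nonneg show "Inf ?S = 0" by (rule antisym[rotated])
    qed auto
    also have "\<dots> \<longleftrightarrow> (\<forall>h>0. \<exists>u. 0 < u \<and> u < h \<and> Y u \<omega> = 0)"
      using * by (auto simp: Inf_less_iff) (metis less_imp_le)+
    finally show ?thesis by (simp add: hitting_time_def)
  qed
  with eq have "AE \<omega> in M. (hitting_time (\<lambda>t. 0 + X t \<omega>) {0} = 0) \<longleftrightarrow> (\<forall>h>0. \<exists>u. 0 < u \<and> u < h \<and> Y u \<omega> = 0)"
    by (rule eventually_mono)
  then show ?thesis
    unfolding regular_for_def Y.zero_regular_def by (rule eventually_subst)
qed

end

theorem theorem1p1:
  fixes M :: "'w measure" and X :: "real \<Rightarrow> 'w \<Rightarrow> real ^ 'n"
  assumes "levy_process M X"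
  shows "(\<forall>q :: real ^ 'n \<Rightarrow> real. q \<in> borel_measurable borel \<longrightarrow>
            ((\<exists>l>0. condition_II M X l q) \<longleftrightarrow> (\<forall>l>0. condition_II M X l q)))
       \<and> ({q \<in> borel_measurable borel. condition_I M X q}
            \<noteq> {q \<in> borel_measurable borel. \<exists>l>0. condition_II M X l q}
          \<longleftrightarrow> regular_for M X 0 {0})"
proof -
  interpret levy_process M X by (rule assms)
  obtain Y where Y: "right_continuous_levy M Y" and eq: "AE \<omega> in M. \<forall>t\<ge>0. X t \<omega> = Y t \<omega>"
    by (rule right_continuous_version)
  interpret Y: right_continuous_levy M Y by (rule Y)
  note I_iff = condition_I_iff[OF Y eq] and II_iff = condition_II_iff[OF Y eq]
  have rate: "condition_II M X k q" if "q \<in> borel_measurable borel" "0 < l" "0 < k" "condition_II M X l q" for q l k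
    using that Y.small_ball_kato_rate[of "\<lambda>y. ennreal \<bar>q y\<bar>" l k] unfolding II_iff by simp
  have II_I: "condition_I M X q" if "q \<in> borel_measurable borel" "0 < l" "condition_II M X l q" for q l
    using that Y.small_ball_imp_small_time[of "\<lambda>y. ennreal \<bar>q y\<bar>" l] unfolding I_iff II_iff by simp
  have "regular_for M X 0 {0}" if "{q \<in> borel_measurable borel. condition_I M X q}
      \<noteq> {q \<in> borel_measurable borel. \<exists>l>0. condition_II M X l q}"
  proof (rule ccontr)
    assume "\<not> regular_for M X 0 {0}"
    then obtain h p where hp: "0 < h" "p < 1" "\<And>t. 0 < t \<Longrightarrow> \<exists>r>0. prob (Y.hits 0 (ball 0 r) t h) \<le> p"
      using Y.not_zero_regular_escape unfolding regular_for_iff[OF Y eq] by blast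
    have "condition_II M X 1 q" if "q \<in> borel_measurable borel" "condition_I M X q" for q
      using that Y.small_time_imp_small_ball[of "\<lambda>y. ennreal \<bar>q y\<bar>", OF _ _ hp]
      unfolding I_iff II_iff by simp
    then show False using that II_I zero_less_one by blast
  qed
  moreover have "{q \<in> borel_measurable borel. condition_I M X q}
      \<noteq> {q \<in> borel_measurable borel. \<exists>l>0. condition_II M X l q}" if "regular_for M X 0 {0}"
  proof -
    have "Y.zero_regular" using that unfolding regular_for_iff[OF Y eq] .
    from Y.exists_small_time_not_small_ball[OF Y.zero_regular_return[OF this]]
    obtain q where "q \<in> borel_measurable borel" "condition_I M X q" "\<not> condition_II M X 1 q"
      unfolding I_iff II_iff by blast
    then show ?thesis using rate zero_less_one by blast
  qed
  moreover have "\<exists>l>0. condition_II M X l q" if "\<forall>l>0. condition_II M X l q" for q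
    using that zero_less_one by blast
  ultimately show ?thesis using rate by blast
qed

end
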